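(* Consider Direct Availability-Graded Broadcast (rules R1–R4 of the context) among $n\ge3f+1$ parties, at most $f$ of them Byzantine. In every execution, regardless of timing, for every view $v$: (a) (Local uniqueness and sender integrity) Each correct party completes $v$ at most once and emits at most one direct-seal result for $v$. Every completion names a proposal received directly from $\mathsf{Proposer}(v)$ by a correct echoer. If $\mathsf{Proposer}(v)$ is correct and proposes $B_v=(C,T)$, every completion names that proposal and every direct result for view $v$ names the payload $(C,T)$. (b) (Value agreement) All correct proposal-ready statements, proposal-ready quorums, and completions for $v$ derive from one view proposal $B_v=(C,T)$. (c) (Grade compatibility) A grade-1 proposal-ready quorum and a grade-0 proposal-ready quorum cannot both exist. Hence correct parties never emit conflicting direct outcomes $\mathsf{commit\text{-}full}$ and $\mathsf{commit\text{-}core}$; either may coexist with the same open (completed, unsealed) state $\mathsf{open\text{-}tip}(C,T)$ at another party. (Parties that have not counted a completion quorum may still remain without a completion.) (d) (Eligibility witness) Completion with $(C,T)$ implies $\mathsf{Witnessed}(C)$; a grade-1 proposal-ready quorum for $(C,T)$ also implies $\mathsf{Witnessed}(T)$. In the Vantage instantiation these properties mean that every named valid lane prefix is author-backed and retrievable. (e) (Ready–refusal exclusion) A proposal-ready quorum and a no-ready quorum for view $v$ cannot both exist.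
   Context: Model. $n\ge 3f+1$ parties $p_1,\dots,p_n$, at most $f$ Byzantine (arbitrary behavior, fixed before the execution), others correct. $Q=n-f$; a quorum is a set of $Q$ parties. Channels between parties are reliable and authenticated (the receiver learns the sender; no forging between correct parties), authentication is not transferable. A broadcast includes the sender, which delivers to itself immediately. All counts are over distinct authors of messages received directly from those authors. No timing assumption is made: messages between correct parties are delivered eventually; clocks, entry events and timeouts may occur at arbitrary times. Direct AGB in view $v$, with designated proposer $\mathsf{Proposer}(v)$. A proposal is a pair $B=(C,T)$ (core manifest, tip manifest). The primitive is parameterized by a deterministic syntactic predicate $\mathsf{Formed}_v(C,T)$ and, for each party $p_i$, local predicates $\mathsf{CoreOK}_i(C)$, $\mathsf{TipOK}_i(C,T)$ evaluated on its local state. Each formed manifest $M$ has a finite deterministic item sequence $\mathsf{Items}(M)$; $\mathsf{Witnessed}(M)$ means every item of $\mathsf{Items}(M)$ is externally valid and permanently retrievable. The eligibility contract is: for correct $p_i$, $\mathsf{CoreOK}_i(C)\Rightarrow\mathsf{Witnessed}(C)$ and $\mathsf{TipOK}_i(C,T)\Rightarrow\mathsf{Witnessed}(T)$. Idempotent local environment events $\mathsf{activate}(v)$ and $\mathsf{enter}(v)$ (the latter at time $e_i(v)$ at $p_i$) occur at arbitrary times. Constants: $\theta_E=3\Delta$, $\theta_R=4\Delta$. (R1) A correct proposer broadcasts a single proposal $(C,T)$ satisfying $\mathsf{Formed}_v$. (R2) $p_i$ fixes the first view-$v$ proposal received directly from $\mathsf{Proposer}(v)$ and ignores later ones; if it is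 not formed it is never echoed. A fixed formed proposal is active after $\mathsf{activate}(v)$ or $\mathsf{enter}(v)$. While its echo-stage response is pending and the proposal active, as soon as $\mathsf{CoreOK}_i(C)$ and $\mathsf{TipOK}_i(C,T)$ both hold, $p_i$ broadcasts a grade-1 (proposal) ECHO of $(C,T)$. After $\mathsf{enter}(v)$, with $t$ the later of entry and direct receipt of the fixed formed proposal, if nothing was sent by the end of $[t,\min\{t+\Delta,e_i(v)+\theta_E\}]$, $p_i$ broadcasts a grade-0 ECHO of $(C,T)$ if $\mathsf{CoreOK}_i(C)$ holds and $\mathsf{echo\text{-}skip}$ otherwise. If no formed proposal is active by $e_i(v)+\theta_E$ it broadcasts $\mathsf{echo\text{-}skip}$. A correct party sends at most one echo-stage response (ECHO or echo-skip) per view. (R3) While its initial ready-stage response is pending (independently of entry), upon counting $Q$ ECHOs of any grade naming one $B$, $p_i$ broadcasts a proposal-ready statement READY for $B$ with grade 1 (resp. 0) if it has counted $Q$ grade-1 (resp. grade-0) ECHOs for $B$, else grade mix. A mix READY is provisional: if one grade reaches $Q$ ECHOs for $B$ before all $n$ echo-stage responses are counted and before $e_i(v)+\theta_R$, $p_i$ broadcasts one refinement READY for the same $B$ with that grade. If $p_i$ has entered and sent no READY by $e_i(v)+\theta_R$ it broadcasts $\mathsf{no\text{-}ready}$. A correct party sends exactly one of READY or no-ready as its initial ready-stage response. A receiver counts only the first echo-stage and the first ready-stage statement of each author; after a first-counted READY-mix for $B$ it also accepts one later homogeneous READY for the same $B$ into that grade's tally without counting the author again. (R4) Upon counting $Q$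 READYs for a common $B=(C,T)$, grades ignored, $p_i$ completes $v$ with $B$ (first time only); a completed view without direct result is $\mathsf{open\text{-}tip}(C,T)$. Upon the first homogeneous quorum it emits a direct-seal result: $\mathsf{commit\text{-}full}(C,T)$ for $Q$ grade-1 READYs for $B$, $\mathsf{commit\text{-}core}(C)$ for $Q$ grade-0 READYs for $B$. A proposal-ready quorum is a set of $Q$ authors whose counted READYs name one proposal; a grade-$g$ one has all grades equal to $g$; a no-ready quorum is $Q$ authors whose initial ready-stage response is no-ready. Vantage instantiation (used only in the last sentence of (d)). Each author $p_a$ publishes hash-linked blocks on its lane by $\mathsf{publish}$ messages to all; a valid lane prefix is a chain with one author index, consecutive heights and matching predecessor hashes from genesis, all blocks satisfying a fixed predicate $\mathsf{BlockOK}$; a manifest lists references $(a,k,h)$ naming such prefixes. $\mathsf{DirectPub}_j(a,k,h)$: $p_j$ holds the valid prefix ending at $h$ and received all its blocks in $\mathsf{publish}$ messages directly from $p_a$. A correct party acknowledges $(a,k,h)$ only if $\mathsf{DirectPub}$ holds there, and permanently retains prefixes it acknowledges or relies on in a check. $\mathsf{AuthorOK}_j$: for each entry, $\mathsf{DirectPub}_j$ or $f+1$ directly received acknowledgments from distinct parties. $\mathsf{CoreOK}_i(C)=\mathsf{AuthorOK}_i(C)$; $\mathsf{TipOK}_i(C,T)$ is $\mathsf{AuthorOK}_i(T)$ together with: for each author in both manifests $p_i$ holds the tip entry's prefix and it strictly contains the core entry. Author-backed: some correct party permanently holds the prefix and received all its blocks in $\mathsf{publish}$ messages directly from the encoded author.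 Retrievable: some correct party permanently retains it. *)

theory Defs
  imports Complex_Main
begin

section \<open>Direct availability-graded broadcast\<close>

type_synonym party = nat
type_synonym view = nat
type_synonym 'm proposal = "'m \<times> 'm"

datatype grade = G0 | G1
datatype rgrade = Hom grade | Mix

datatype 'm msg =
    Proposal view "'m proposal"
  | Echo view grade "'m proposal"
  | Echo_Skip view
  | Ready view rgrade "'m proposal"
  | No_Ready view

fun view_of :: "'m msg \<Rightarrow> view" where
  "view_of (Proposal v B) = v"
| "view_of (Echo v g B) = v"
| "view_of (Echo_Skip v) = v"
| "view_of (Ready v g B) = v"
| "view_of (No_Ready v) = v"

datatype 'm result = Commit_Full 'm 'm | Commit_Core 'm

fun direct_result :: "grade \<Rightarrow> 'm proposal \<Rightarrow> 'm result" where
  "direct_result G1 (C, T) = Commit_Full C T"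
| "direct_result G0 (C, T) = Commit_Core C"

text \<open>Parties are the numbers below \<open>nparties\<close>. The set of Byzantine parties is a parameter,
  so it is fixed before the execution.\<close>

record ('m, 'x) params =
  nparties :: nat
  nfaulty :: nat
  byzantine :: "party set"
  proposer :: "view \<Rightarrow> party"
  formed :: "view \<Rightarrow> 'm proposal \<Rightarrow> bool"
  Delta :: real
  items :: "'m \<Rightarrow> 'x list"
  ext_valid :: "'x \<Rightarrow> bool"

definition correct :: "('m, 'x) params \<Rightarrow> party \<Rightarrow> bool" where
  "correct P i \<longleftrightarrow> i < nparties P \<and> i \<notin> byzantine P"

definition quorum_size :: "('m, 'x) params \<Rightarrow> nat" where
  "quorum_size P = nparties P - nfaulty P"

definition theta_E :: "('m, 'x) params \<Rightarrow> real" where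
  "theta_E P = 3 * Delta P"

definition theta_R :: "('m, 'x) params \<Rightarrow> real" where
  "theta_R P = 4 * Delta P"

definition system :: "('m, 'x) params \<Rightarrow> bool" where
  "system P \<longleftrightarrow>
     3 * nfaulty P + 1 \<le> nparties P \<and>
     byzantine P \<subseteq> {..<nparties P} \<and> card (byzantine P) \<le> nfaulty P \<and>
     (\<forall>v. proposer P v < nparties P) \<and> 0 < Delta P"

subsection \<open>Local state of one correct party in one view\<close>

text \<open>\<open>fixed\<close> is the first proposal received from the designated proposer, with the local clock
  reading at its receipt. \<open>echo_cnt\<close> and \<open>ready_cnt\<close> hold the first statement of each author;
  \<open>refined\<close> holds the grade of the homogeneous READY accepted after a first-counted READY-mix.
  \<open>sent\<close> (broadcast messages), \<open>completions\<close> and \<open>seals\<close> are append-only logs.\<close>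

record 'm vstate =
  fixed :: "('m proposal \<times> real) option"
  activated :: bool
  entry :: "real option"
  echo_cnt :: "party \<Rightarrow> 'm msg option"
  ready_cnt :: "party \<Rightarrow> 'm msg option"
  refined :: "party \<Rightarrow> grade option"
  sent :: "'m msg list"
  completions :: "'m proposal list"
  seals :: "'m result list"

definition init :: "'m vstate" where
  "init = \<lparr>fixed = None, activated = False, entry = None,
     echo_cnt = (\<lambda>_. None), ready_cnt = (\<lambda>_. None), refined = (\<lambda>_. None),
     sent = [], completions = [], seals = []\<rparr>"

definition echo_authors :: "view \<Rightarrow> 'm vstate \<Rightarrow> 'm proposal \<Rightarrow> party set" where
  "echo_authors v st B = {a. \<exists>g. echo_cnt st a = Some (Echo v g B)}"

definition graded_echo_authors ::
    "view \<Rightarrow> 'm vstate \<Rightarrow> grade \<Rightarrow> 'm proposal \<Rightarrow> party set" where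
  "graded_echo_authors v st g B = {a. echo_cnt st a = Some (Echo v g B)}"

definition ready_authors :: "view \<Rightarrow> 'm vstate \<Rightarrow> 'm proposal \<Rightarrow> party set" where
  "ready_authors v st B = {a. \<exists>g. ready_cnt st a = Some (Ready v g B)}"

definition graded_ready_authors ::
    "view \<Rightarrow> 'm vstate \<Rightarrow> grade \<Rightarrow> 'm proposal \<Rightarrow> party set" where
  "graded_ready_authors v st g B =
     {a. ready_cnt st a = Some (Ready v (Hom g) B) \<or>
         ready_cnt st a = Some (Ready v Mix B) \<and> refined st a = Some g}"

definition no_ready_authors :: "view \<Rightarrow> 'm vstate \<Rightarrow> party set" where
  "no_ready_authors v st = {a. ready_cnt st a = Some (No_Ready v)}"

definition ready_quorum ::
    "('m, 'x) params \<Rightarrow> view \<Rightarrow> 'm vstate \<Rightarrow> 'm proposal \<Rightarrow> bool" where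
  "ready_quorum P v st B \<longleftrightarrow>
     (\<exists>S. card S = quorum_size P \<and> S \<subseteq> ready_authors v st B)"

definition graded_ready_quorum ::
    "('m, 'x) params \<Rightarrow> view \<Rightarrow> 'm vstate \<Rightarrow> grade \<Rightarrow> 'm proposal \<Rightarrow> bool" where
  "graded_ready_quorum P v st g B \<longleftrightarrow>
     (\<exists>S. card S = quorum_size P \<and> S \<subseteq> graded_ready_authors v st g B)"

definition no_ready_quorum :: "('m, 'x) params \<Rightarrow> view \<Rightarrow> 'm vstate \<Rightarrow> bool" where
  "no_ready_quorum P v st \<longleftrightarrow>
     (\<exists>S. card S = quorum_size P \<and> S \<subseteq> no_ready_authors v st)"

definition open_tip :: "'m vstate \<Rightarrow> 'm proposal \<Rightarrow> bool" where
  "open_tip st B \<longleftrightarrow> B \<in> set (completions st) \<and> seals st = []"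

subsection \<open>Local transition\<close>

text \<open>\<open>receive P now a m st\<close>: message \<open>m\<close> arrives directly from \<open>a\<close> at local clock reading \<open>now\<close>.\<close>

fun receive ::
    "('m, 'x) params \<Rightarrow> real \<Rightarrow> party \<Rightarrow> 'm msg \<Rightarrow> 'm vstate \<Rightarrow> 'm vstate" where
  "receive P now a (Proposal v B) st =
     (if a = proposer P v \<and> fixed st = None then st\<lparr>fixed := Some (B, now)\<rparr> else st)"
| "receive P now a (Echo v g B) st =
     (if echo_cnt st a = None
      then st\<lparr>echo_cnt := (echo_cnt st)(a := Some (Echo v g B))\<rparr> else st)"
| "receive P now a (Echo_Skip v) st =
     (if echo_cnt st a = None
      then st\<lparr>echo_cnt := (echo_cnt st)(a := Some (Echo_Skip v))\<rparr> else st)"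
| "receive P now a (Ready v g B) st =
     (if ready_cnt st a = None
      then st\<lparr>ready_cnt := (ready_cnt st)(a := Some (Ready v g B))\<rparr>
      else if ready_cnt st a = Some (Ready v Mix B) \<and> refined st a = None
      then (case g of Hom h \<Rightarrow> st\<lparr>refined := (refined st)(a := Some h)\<rparr> | Mix \<Rightarrow> st)
      else st)"
| "receive P now a (No_Ready v) st =
     (if ready_cnt st a = None
      then st\<lparr>ready_cnt := (ready_cnt st)(a := Some (No_Ready v))\<rparr> else st)"

text \<open>A broadcast is delivered to its sender immediately.\<close>

definition broadcast ::
    "('m, 'x) params \<Rightarrow> real \<Rightarrow> party \<Rightarrow> 'm msg \<Rightarrow> 'm vstate \<Rightarrow> 'm vstate" where
  "broadcast P now i m st = receive P now i m (st\<lparr>sent := sent st @ [m]\<rparr>)"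

datatype 'm input =
    Propose view "'m proposal"
  | Activate view
  | Enter view
  | Deliver party "'m msg"
  | Tick

definition input_stage ::
    "('m, 'x) params \<Rightarrow> real \<Rightarrow> party \<Rightarrow> view \<Rightarrow> 'm input \<Rightarrow> 'm vstate \<Rightarrow> 'm vstate" where
  "input_stage P now i v inp st =
     (case inp of
        Propose w B \<Rightarrow>
          if w = v \<and> i = proposer P v \<and> formed P v B \<and> (\<forall>B'. Proposal v B' \<notin> set (sent st))
          then broadcast P now i (Proposal v B) st else st
      | Activate w \<Rightarrow> if w = v then st\<lparr>activated := True\<rparr> else st
      | Enter w \<Rightarrow> if w = v \<and> entry st = None then st\<lparr>entry := Some now\<rparr> else st
      | Deliver a m \<Rightarrow> if view_of m = v then receive P now a m st else st
      | Tick \<Rightarrow> st)"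

text \<open>The echo-stage response due at clock reading \<open>now\<close>, if any; \<open>core\<close> and \<open>tip\<close> are the current
  values of the party's local predicates. A fixed formed proposal received at \<open>r\<close> counts as active
  by the cut-off \<open>e + theta_E\<close> only if \<open>r\<close> does not exceed it. A deadline is served by the first
  local step at or after it; the grade-1 ECHO is possible up to and including the deadline.\<close>

definition echo_response ::
    "('m, 'x) params \<Rightarrow> real \<Rightarrow> ('m \<Rightarrow> bool) \<Rightarrow> ('m \<Rightarrow> 'm \<Rightarrow> bool) \<Rightarrow> view \<Rightarrow> 'm vstate
      \<Rightarrow> 'm msg option" where
  "echo_response P now core tip v st =
     (case entry st of
        None \<Rightarrow>
          (case fixed st of
             None \<Rightarrow> None
           | Some ((C, T), r) \<Rightarrow>
               if formed P v (C, T) \<and> activated st \<and> core C \<and> tip C T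
               then Some (Echo v G1 (C, T)) else None)
      | Some e \<Rightarrow>
          let skip = (if e + theta_E P \<le> now then Some (Echo_Skip v) else None) in
          (case fixed st of
             None \<Rightarrow> skip
           | Some ((C, T), r) \<Rightarrow>
               if formed P v (C, T) \<and> r \<le> e + theta_E P
               then let d = min (max e r + Delta P) (e + theta_E P) in
                    if now \<le> d \<and> core C \<and> tip C T then Some (Echo v G1 (C, T))
                    else if d \<le> now
                    then Some (if core C then Echo v G0 (C, T) else Echo_Skip v)
                    else None
               else skip))"

definition echo_pending :: "view \<Rightarrow> 'm vstate \<Rightarrow> bool" where
  "echo_pending v st \<longleftrightarrow>
     Echo_Skip v \<notin> set (sent st) \<and> (\<forall>g B. Echo v g B \<notin> set (sent st))"

definition echo_stage ::
    "('m, 'x) params \<Rightarrow> real \<Rightarrow> ('m \<Rightarrow> bool) \<Rightarrow> ('m \<Rightarrow> 'm \<Rightarrow> bool) \<Rightarrow> party \<Rightarrow> view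
      \<Rightarrow> 'm vstate \<Rightarrow> 'm vstate" where
  "echo_stage P now core tip i v st =
     (if echo_pending v st
      then (case echo_response P now core tip v st of
              None \<Rightarrow> st | Some m \<Rightarrow> broadcast P now i m st)
      else st)"

definition ready_pending :: "view \<Rightarrow> 'm vstate \<Rightarrow> bool" where
  "ready_pending v st \<longleftrightarrow>
     No_Ready v \<notin> set (sent st) \<and> (\<forall>g B. Ready v g B \<notin> set (sent st))"

definition ready_grade ::
    "('m, 'x) params \<Rightarrow> view \<Rightarrow> 'm vstate \<Rightarrow> 'm proposal \<Rightarrow> rgrade" where
  "ready_grade P v st B =
     (if quorum_size P \<le> card (graded_echo_authors v st G1 B) then Hom G1
      else if quorum_size P \<le> card (graded_echo_authors v st G0 B) then Hom G0
      else Mix)"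

text \<open>The choices by \<open>SOME\<close> below are between at most one candidate, because two quorums of
  authors intersect and each author is counted once.\<close>

definition ready_stage ::
    "('m, 'x) params \<Rightarrow> real \<Rightarrow> party \<Rightarrow> view \<Rightarrow> 'm vstate \<Rightarrow> 'm vstate" where
  "ready_stage P now i v st =
     (if \<not> ready_pending v st then st
      else if (\<exists>B. quorum_size P \<le> card (echo_authors v st B)) \<and>
              (\<forall>e. entry st = Some e \<longrightarrow> now \<le> e + theta_R P)
      then let B = (SOME B. quorum_size P \<le> card (echo_authors v st B))
           in broadcast P now i (Ready v (ready_grade P v st B) B) st
      else if \<exists>e. entry st = Some e \<and> e + theta_R P \<le> now
      then broadcast P now i (No_Ready v) st
      else st)"

definition refinable ::
    "('m, 'x) params \<Rightarrow> real \<Rightarrow> view \<Rightarrow> 'm vstate \<Rightarrow> grade \<Rightarrow> 'm proposal \<Rightarrow> bool" where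
  "refinable P now v st g B \<longleftrightarrow>
     Ready v Mix B \<in> set (sent st) \<and> (\<forall>h. Ready v (Hom h) B \<notin> set (sent st)) \<and>
     quorum_size P \<le> card (graded_echo_authors v st g B) \<and>
     card {a. echo_cnt st a \<noteq> None} < nparties P \<and>
     (\<forall>e. entry st = Some e \<longrightarrow> now < e + theta_R P)"

definition refine_stage ::
    "('m, 'x) params \<Rightarrow> real \<Rightarrow> party \<Rightarrow> view \<Rightarrow> 'm vstate \<Rightarrow> 'm vstate" where
  "refine_stage P now i v st =
     (if \<exists>g B. refinable P now v st g B
      then let (g, B) = (SOME (g, B). refinable P now v st g B)
           in broadcast P now i (Ready v (Hom g) B) st
      else st)"

definition complete_stage ::
    "('m, 'x) params \<Rightarrow> view \<Rightarrow> 'm vstate \<Rightarrow> 'm vstate" where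
  "complete_stage P v st =
     (if completions st = [] \<and> (\<exists>B. quorum_size P \<le> card (ready_authors v st B))
      then st\<lparr>completions := completions st @
             [SOME B. quorum_size P \<le> card (ready_authors v st B)]\<rparr>
      else st)"

definition seal_stage ::
    "('m, 'x) params \<Rightarrow> view \<Rightarrow> 'm vstate \<Rightarrow> 'm vstate" where
  "seal_stage P v st =
     (if seals st = [] \<and> (\<exists>g B. quorum_size P \<le> card (graded_ready_authors v st g B))
      then let (g, B) = (SOME (g, B). quorum_size P \<le> card (graded_ready_authors v st g B))
           in st\<lparr>seals := seals st @ [direct_result g B]\<rparr>
      else st)"

definition local_step ::
    "('m, 'x) params \<Rightarrow> real \<Rightarrow> ('m \<Rightarrow> bool) \<Rightarrow> ('m \<Rightarrow> 'm \<Rightarrow> bool) \<Rightarrow> party \<Rightarrow> view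
      \<Rightarrow> 'm input \<Rightarrow> 'm vstate \<Rightarrow> 'm vstate" where
  "local_step P now core tip i v inp st =
     seal_stage P v (complete_stage P v (refine_stage P now i v (ready_stage P now i v
       (echo_stage P now core tip i v (input_stage P now i v inp st)))))"

subsection \<open>Executions\<close>

text \<open>An execution is an infinite sequence of local steps of correct parties, possibly with gaps
  (\<open>None\<close>). The local clocks, the values of the local predicates at each step, and the items
  retrievable at each step are part of the environment.\<close>

record ('m, 'x) execution =
  event :: "nat \<Rightarrow> (party \<times> 'm input) option"
  clock :: "party \<Rightarrow> nat \<Rightarrow> real"
  coreOK :: "party \<Rightarrow> nat \<Rightarrow> 'm \<Rightarrow> bool"
  tipOK :: "party \<Rightarrow> nat \<Rightarrow> 'm \<Rightarrow> 'm \<Rightarrow> bool"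
  retrievable :: "nat \<Rightarrow> 'x \<Rightarrow> bool"

text \<open>\<open>state P E k i v\<close> is the state of \<open>i\<close> in view \<open>v\<close> after the events with index below \<open>k\<close>.\<close>

primrec state ::
    "('m, 'x) params \<Rightarrow> ('m, 'x) execution \<Rightarrow> nat \<Rightarrow> party \<Rightarrow> view \<Rightarrow> 'm vstate" where
  "state P E 0 = (\<lambda>i v. init)"
| "state P E (Suc k) =
     (case event E k of
        None \<Rightarrow> state P E k
      | Some (i, inp) \<Rightarrow>
          (state P E k)(i := (\<lambda>v. local_step P (clock E i k) (coreOK E i k) (tipOK E i k) i v inp
                                  (state P E k i v))))"

definition has_sent ::
    "('m, 'x) params \<Rightarrow> ('m, 'x) execution \<Rightarrow> party \<Rightarrow> nat \<Rightarrow> 'm msg \<Rightarrow> bool" where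
  "has_sent P E i k m \<longleftrightarrow> m \<in> set (sent (state P E k i (view_of m)))"

definition has_received ::
    "('m, 'x) params \<Rightarrow> ('m, 'x) execution \<Rightarrow> party \<Rightarrow> nat \<Rightarrow> party \<Rightarrow> 'm msg \<Rightarrow> bool" where
  "has_received P E i k a m \<longleftrightarrow>
     (\<exists>k'<k. event E k' = Some (i, Deliver a m)) \<or> (i = a \<and> has_sent P E i k m)"

text \<open>Byzantine parties can have anything delivered at any time, and different messages to different
  receivers; a message from a correct party must have been broadcast by it, and it eventually reaches every
  correct party. Messages may be reordered and duplicated.\<close>

definition execution :: "('m, 'x) params \<Rightarrow> ('m, 'x) execution \<Rightarrow> bool" where
  "execution P E \<longleftrightarrow>
     system P \<and>
     (\<forall>i. mono (clock E i)) \<and>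
     (\<forall>k i inp. event E k = Some (i, inp) \<longrightarrow> correct P i) \<and>
     (\<forall>k i a m. event E k = Some (i, Deliver a m) \<longrightarrow>
        a < nparties P \<and> a \<noteq> i \<and> (correct P a \<longrightarrow> has_sent P E a k m)) \<and>
     (\<forall>k i a m. correct P i \<longrightarrow> correct P a \<longrightarrow> has_sent P E a k m \<longrightarrow>
        (\<exists>k'. has_received P E i k' a m))"

definition witnessed :: "('m, 'x) params \<Rightarrow> ('m, 'x) execution \<Rightarrow> nat \<Rightarrow> 'm \<Rightarrow> bool" where
  "witnessed P E k M \<longleftrightarrow>
     (\<forall>x\<in>set (items P M). ext_valid P x \<and> (\<forall>k'\<ge>k. retrievable E k' x))"

definition eligibility_contract :: "('m, 'x) params \<Rightarrow> ('m, 'x) execution \<Rightarrow> bool" where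
  "eligibility_contract P E \<longleftrightarrow>
     (\<forall>i k C T. correct P i \<longrightarrow>
        (coreOK E i k C \<longrightarrow> witnessed P E k C) \<and>
        (tipOK E i k C T \<longrightarrow> witnessed P E k T))"


section \<open>The Vantage instantiation\<close>

record ('h, 'd) block =
  author :: party
  height :: nat
  pred_hash :: 'h
  payload :: 'd

type_synonym 'h ref = "party \<times> nat \<times> 'h"

text \<open>The message components are cumulative: \<open>pub_recv V i k\<close> contains \<open>(s, b)\<close> if by step \<open>k\<close>
  party \<open>i\<close> has received a publish message for \<open>b\<close> directly from \<open>s\<close>, and similarly for
  acknowledgments. \<open>held V i k\<close> are the prefixes \<open>i\<close> holds at step \<open>k\<close>, whatever their source;
  it need not be monotone.\<close>

record ('m, 'h, 'd) vantage =
  entries :: "'m \<Rightarrow> 'h ref list"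
  hash :: "('h, 'd) block \<Rightarrow> 'h"
  genesis :: "party \<Rightarrow> 'h"
  block_ok :: "('h, 'd) block \<Rightarrow> bool"
  published :: "party \<Rightarrow> nat \<Rightarrow> ('h, 'd) block set"
  pub_recv :: "party \<Rightarrow> nat \<Rightarrow> (party \<times> ('h, 'd) block) set"
  ack_sent :: "party \<Rightarrow> nat \<Rightarrow> 'h ref set"
  ack_recv :: "party \<Rightarrow> nat \<Rightarrow> (party \<times> 'h ref) set"
  held :: "party \<Rightarrow> nat \<Rightarrow> ('h, 'd) block list set"

text \<open>Genesis is represented by its hash; the first block of a lane has height 1.\<close>

definition lane_chain :: "('m, 'h, 'd) vantage \<Rightarrow> party \<Rightarrow> ('h, 'd) block list \<Rightarrow> bool" where
  "lane_chain V a bs \<longleftrightarrow>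
     (\<forall>l<length bs. author (bs ! l) = a \<and> height (bs ! l) = Suc l \<and>
        pred_hash (bs ! l) = (if l = 0 then genesis V a else hash V (bs ! (l - 1))))"

definition valid_prefix :: "('m, 'h, 'd) vantage \<Rightarrow> party \<Rightarrow> ('h, 'd) block list \<Rightarrow> bool" where
  "valid_prefix V a bs \<longleftrightarrow> lane_chain V a bs \<and> (\<forall>b\<in>set bs. block_ok V b)"

fun names :: "('m, 'h, 'd) vantage \<Rightarrow> 'h ref \<Rightarrow> ('h, 'd) block list \<Rightarrow> bool" where
  "names V (a, h, x) bs \<longleftrightarrow>
     valid_prefix V a bs \<and> bs \<noteq> [] \<and> length bs = h \<and> hash V (last bs) = x"

definition direct_pub_by ::
    "('m, 'h, 'd) vantage \<Rightarrow> party \<Rightarrow> nat \<Rightarrow> 'h ref \<Rightarrow> ('h, 'd) block list \<Rightarrow> bool" where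
  "direct_pub_by V i k r bs \<longleftrightarrow>
     names V r bs \<and> bs \<in> held V i k \<and> (\<forall>b\<in>set bs. (fst r, b) \<in> pub_recv V i k)"

definition direct_pub :: "('m, 'h, 'd) vantage \<Rightarrow> party \<Rightarrow> nat \<Rightarrow> 'h ref \<Rightarrow> bool" where
  "direct_pub V i k r \<longleftrightarrow> (\<exists>bs. direct_pub_by V i k r bs)"

definition author_ok ::
    "('m, 'x) params \<Rightarrow> ('m, 'h, 'd) vantage \<Rightarrow> party \<Rightarrow> nat \<Rightarrow> 'm \<Rightarrow> bool" where
  "author_ok P V i k M \<longleftrightarrow>
     (\<forall>r\<in>set (entries V M).
        direct_pub V i k r \<or> nfaulty P + 1 \<le> card {a. (a, r) \<in> ack_recv V i k})"

definition tip_extends :: "('m, 'h, 'd) vantage \<Rightarrow> party \<Rightarrow> nat \<Rightarrow> 'm \<Rightarrow> 'm \<Rightarrow> bool" where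
  "tip_extends V i k C T \<longleftrightarrow>
     (\<forall>r\<in>set (entries V T). \<forall>c\<in>set (entries V C). fst r = fst c \<longrightarrow>
        (\<exists>bs\<in>held V i k. names V r bs \<and>
           fst (snd c) < length bs \<and> names V c (take (fst (snd c)) bs)))"

definition keeps ::
    "('m, 'h, 'd) vantage \<Rightarrow> party \<Rightarrow> nat \<Rightarrow> ('h, 'd) block list \<Rightarrow> bool" where
  "keeps V i k bs \<longleftrightarrow> (\<forall>k'\<ge>k. bs \<in> held V i k')"

text \<open>The prefixes that a party relies on when it echoes \<open>(C, T)\<close> with grade \<open>g\<close> at step \<open>k\<close>: those
  that establish \<open>DirectPub\<close> for an entry checked for that grade, and for grade 1 also the held tip
  prefixes of authors occurring in both manifests.\<close>

definition relies_on ::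
    "('m, 'h, 'd) vantage \<Rightarrow> party \<Rightarrow> nat \<Rightarrow> grade \<Rightarrow> 'm proposal \<Rightarrow> ('h, 'd) block list \<Rightarrow> bool"
where
  "relies_on V i k g B bs \<longleftrightarrow>
     (\<exists>r\<in>set (entries V (fst B)). direct_pub_by V i k r bs) \<or>
     g = G1 \<and>
     (\<exists>r\<in>set (entries V (snd B)). direct_pub_by V i k r bs \<or>
        bs \<in> held V i k \<and> names V r bs \<and> (\<exists>c\<in>set (entries V (fst B)). fst c = fst r))"

definition vantage_execution ::
    "('m, 'x) params \<Rightarrow> ('m, 'x) execution \<Rightarrow> ('m, 'h, 'd) vantage \<Rightarrow> bool" where
  "vantage_execution P E V \<longleftrightarrow>
     execution P E \<and>
     \<comment> \<open>authenticated reliable channels, with immediate self-delivery\<close>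
     (\<forall>i. correct P i \<longrightarrow>
        mono (published V i) \<and> mono (pub_recv V i) \<and> mono (ack_sent V i) \<and> mono (ack_recv V i)) \<and>
     (\<forall>i k a b. correct P i \<longrightarrow> (a, b) \<in> pub_recv V i k \<longrightarrow>
        a < nparties P \<and> (correct P a \<longrightarrow> b \<in> published V a k)) \<and>
     (\<forall>i k a r. correct P i \<longrightarrow> (a, r) \<in> ack_recv V i k \<longrightarrow>
        a < nparties P \<and> (correct P a \<longrightarrow> r \<in> ack_sent V a k)) \<and>
     (\<forall>i a k b. correct P i \<longrightarrow> correct P a \<longrightarrow> b \<in> published V a k \<longrightarrow>
        (\<exists>k'. (a, b) \<in> pub_recv V i k') \<and> (i = a \<longrightarrow> (a, b) \<in> pub_recv V i k)) \<and>
     (\<forall>i a k r. correct P i \<longrightarrow> correct P a \<longrightarrow> r \<in> ack_sent V a k \<longrightarrow>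
        (\<exists>k'. (a, r) \<in> ack_recv V i k') \<and> (i = a \<longrightarrow> (a, r) \<in> ack_recv V i k)) \<and>
     \<comment> \<open>rules of the correct parties\<close>
     (\<forall>a k. correct P a \<longrightarrow> (\<exists>bs. lane_chain V a bs \<and> published V a k = set bs)) \<and>
     (\<forall>i k r. correct P i \<longrightarrow> r \<in> ack_sent V i k \<longrightarrow>
        (\<exists>k'\<le>k. \<exists>bs. direct_pub_by V i k' r bs \<and> keeps V i k' bs)) \<and>
     (\<forall>i k v g B bs. correct P i \<longrightarrow>
        has_sent P E i (Suc k) (Echo v g B) \<longrightarrow> \<not> has_sent P E i k (Echo v g B) \<longrightarrow>
        relies_on V i k g B bs \<longrightarrow> keeps V i k bs) \<and>
     (\<forall>i k C. correct P i \<longrightarrow> coreOK E i k C = author_ok P V i k C) \<and>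
     (\<forall>i k C T. correct P i \<longrightarrow>
        tipOK E i k C T = (author_ok P V i k T \<and> tip_extends V i k C T))"

definition author_backed ::
    "('m, 'x) params \<Rightarrow> ('m, 'h, 'd) vantage \<Rightarrow> nat \<Rightarrow> party \<Rightarrow> ('h, 'd) block list \<Rightarrow> bool" where
  "author_backed P V k a bs \<longleftrightarrow>
     (\<exists>j. correct P j \<and> keeps V j k bs \<and> (\<forall>b\<in>set bs. (a, b) \<in> pub_recv V j k))"

definition prefix_retrievable ::
    "('m, 'x) params \<Rightarrow> ('m, 'h, 'd) vantage \<Rightarrow> nat \<Rightarrow> ('h, 'd) block list \<Rightarrow> bool" where
  "prefix_retrievable P V k bs \<longleftrightarrow> (\<exists>j. correct P j \<and> keeps V j k bs)"

text \<open>Every reference of the manifest names a valid lane prefix that is author-backed and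
  retrievable; if the hash is free of collisions, this is the only prefix it names.\<close>

definition lanes_witnessed ::
    "('m, 'x) params \<Rightarrow> ('m, 'h, 'd) vantage \<Rightarrow> nat \<Rightarrow> 'm \<Rightarrow> bool" where
  "lanes_witnessed P V k M \<longleftrightarrow>
     (\<forall>r\<in>set (entries V M).
        (\<exists>bs. names V r bs \<and> author_backed P V k (fst r) bs \<and> prefix_retrievable P V k bs) \<and>
        (inj (hash V) \<longrightarrow>
           (\<forall>bs. names V r bs \<longrightarrow>
              author_backed P V k (fst r) bs \<and> prefix_retrievable P V k bs)))"

end

theory Submission
  imports Defs
begin

text \<open>Any two quorums share a correct party, since \<open>2 (n - f) - n = n - 2 f > f\<close>. All READYs rest on
  an ECHO quorum, and a correct party echoes only the one proposal it has fixed, so all of them name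
  one proposal. A single receiver counts each author once, so it can never count a grade-1 and a
  grade-0 ECHO quorum together; hence a correct party sends homogeneous READYs of one grade only,
  even with refinement, and a correct party common to two homogeneous READY quorums forces equal
  grades. All local invariants are stable because counted statements and sent messages only grow.
  For the coexistence claim, one Byzantine author sends READY-mix to a single receiver.\<close>

text \<open>The six stages of a local step, with their deadlines and \<open>SOME\<close> choices,
  are replaced by a nondeterministic relation \<open>micro\<close> that keeps only the guards on
  which safety rests and forgets clocks, activation and deadlines; this is where independence of
  timing comes from. The invariants justify every message ever sent by the current state instead of
  the state at sending time, so that statements made at different moments can be compared. CoreOK
  and TipOK are the exception: they may become false again, so their witness has to be taken at the
  step in which an ECHO first appears. Coexistence requires a concrete run for all \<open>n\<close>
  and all \<open>f\<close> with 1 <= f. For f = 0 it would fail: a quorum is then the set of all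
  parties, no refinement can occur, and whoever completes has counted the same homogeneous READYs as
  whoever seals. Quantifiers over proposals stay unsplit because the lemmas treat the pair of
  manifests as one value \<open>B\<close>.\<close>

declare split_paired_All [simp del] split_paired_Ex [simp del]

section \<open>Quorums\<close>

text \<open>A subset of exact size makes this monotone for arbitrary sets. The condition
  \<open>quorum_size P \<le> card X\<close> is not: \<open>card\<close> is 0 on infinite sets, and
  the local invariants carry no finiteness of author sets.\<close>

definition has_quorum :: "('m, 'x) params \<Rightarrow> party set \<Rightarrow> bool" where
  "has_quorum P X \<longleftrightarrow> (\<exists>S. card S = quorum_size P \<and> S \<subseteq> X)"

lemma has_quorum_mono: "has_quorum P X \<Longrightarrow> X \<subseteq> Y \<Longrightarrow> has_quorum P Y"
  unfolding has_quorum_def by blast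

lemma has_quorumI: "quorum_size P \<le> card X \<Longrightarrow> has_quorum P X"
  unfolding has_quorum_def by (meson obtain_subset_with_card_n)

lemma ready_quorum_iff: "ready_quorum P v st B \<longleftrightarrow> has_quorum P (ready_authors v st B)"
  unfolding ready_quorum_def has_quorum_def ..

lemma graded_ready_quorum_iff:
  "graded_ready_quorum P v st g B \<longleftrightarrow> has_quorum P (graded_ready_authors v st g B)"
  unfolding graded_ready_quorum_def has_quorum_def ..

lemma no_ready_quorum_iff: "no_ready_quorum P v st \<longleftrightarrow> has_quorum P (no_ready_authors v st)"
  unfolding no_ready_quorum_def has_quorum_def ..

text \<open>With \<open>X = Y\<close> it yields a correct member of a single quorum, which is how
  the \<open>_sender\<close> lemmas use it. The bounds are there because author sets are sets of
  naturals and the count is against the number of parties.\<close>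

lemma quorums_share_correct:
  assumes "system P" "has_quorum P X" "has_quorum P Y" "X \<subseteq> {..<nparties P}" "Y \<subseteq> {..<nparties P}"
  obtains a where "a \<in> X" "a \<in> Y" "correct P a"
proof -
  obtain S T where S: "card S = quorum_size P" "S \<subseteq> X" and T: "card T = quorum_size P" "T \<subseteq> Y"
    using assms(2,3) unfolding has_quorum_def by blast
  have sub: "S \<union> T \<subseteq> {..<nparties P}" using S T assms(4,5) by blast
  have fin: "finite S" "finite T" using sub finite_subset by auto
  have "card (S \<union> T) \<le> nparties P" using card_mono[OF _ sub] by simp
  moreover have "card S + card T = card (S \<union> T) + card (S \<inter> T)" using card_Un_Int fin by blast
  moreover have byz: "card (byzantine P) \<le> nfaulty P" "3 * nfaulty P + 1 \<le> nparties P"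
    using assms(1) unfolding system_def by auto
  ultimately have "card (byzantine P) < card (S \<inter> T)"
    using S(1) T(1) unfolding quorum_size_def by linarith
  moreover have "finite (byzantine P)"
    using assms(1) finite_subset unfolding system_def by blast
  ultimately have "\<not> S \<inter> T \<subseteq> byzantine P" using card_mono by (metis not_le)
  then obtain a where "a \<in> S" "a \<in> T" "a \<notin> byzantine P" by blast
  then show ?thesis using that S T sub unfolding correct_def by blast
qed

section \<open>Local steps as sequences of elementary transitions\<close>

text \<open>One READY clause serves both the initial READY and the refinement. For ECHOs,
  \<open>fixed\<close> is written once and thereby settles the value; the exclusion of two grades
  comes from the receiver, which counts one ECHO per author.\<close>

fun may_send ::
    "('m, 'x) params \<Rightarrow> ('m \<Rightarrow> bool) \<Rightarrow> ('m \<Rightarrow> 'm \<Rightarrow> bool) \<Rightarrow> view \<Rightarrow> 'm vstate \<Rightarrow> 'm msg \<Rightarrow> bool"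
where
  "may_send P core tip v st (Proposal w B) \<longleftrightarrow> w = v \<and> (\<forall>B'. Proposal v B' \<notin> set (sent st))"
| "may_send P core tip v st (Echo w g B) \<longleftrightarrow> w = v \<and> (\<exists>r. fixed st = Some (B, r)) \<and>
     core (fst B) \<and> (g = G1 \<longrightarrow> tip (fst B) (snd B))"
| "may_send P core tip v st (Echo_Skip w) \<longleftrightarrow> w = v"
| "may_send P core tip v st (Ready w gr B) \<longleftrightarrow> w = v \<and> No_Ready v \<notin> set (sent st) \<and>
     has_quorum P (echo_authors v st B) \<and>
     (\<forall>g. gr = Hom g \<longrightarrow> has_quorum P (graded_echo_authors v st g B))"
| "may_send P core tip v st (No_Ready w) \<longleftrightarrow> w = v \<and> (\<forall>g B. Ready v g B \<notin> set (sent st))"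

text \<open>The rules are more permissive than the stages; \<open>micro_enter\<close>, for instance,
  may overwrite the entry time. As each stage is a finite sequence of these transitions, an
  invariant has to be checked against six rules only.\<close>

inductive micro ::
    "('m, 'x) params \<Rightarrow> real \<Rightarrow> ('m \<Rightarrow> bool) \<Rightarrow> ('m \<Rightarrow> 'm \<Rightarrow> bool) \<Rightarrow> party \<Rightarrow> view
      \<Rightarrow> 'm input \<Rightarrow> 'm vstate \<Rightarrow> 'm vstate \<Rightarrow> bool"
  for P now core tip i v inp where
  micro_activate: "micro P now core tip i v inp st (st\<lparr>activated := True\<rparr>)"
| micro_enter: "micro P now core tip i v inp st (st\<lparr>entry := Some now\<rparr>)"
| micro_deliver: "inp = Deliver a m \<Longrightarrow> view_of m = v \<Longrightarrow>
    micro P now core tip i v inp st (receive P now a m st)"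
| micro_send: "may_send P core tip v st m \<Longrightarrow>
    micro P now core tip i v inp st (broadcast P now i m st)"
| micro_complete: "completions st = [] \<Longrightarrow> has_quorum P (ready_authors v st B) \<Longrightarrow>
    micro P now core tip i v inp st (st\<lparr>completions := [B]\<rparr>)"
| micro_seal: "seals st = [] \<Longrightarrow> has_quorum P (graded_ready_authors v st g B) \<Longrightarrow>
    micro P now core tip i v inp st (st\<lparr>seals := [direct_result g B]\<rparr>)"

lemma input_stage_micro:
  "(micro P now core tip i v inp)\<^sup>*\<^sup>* st (input_stage P now i v inp st)"
proof (cases inp)
  case (Propose w B)
  then show ?thesis
    unfolding input_stage_def by (auto intro!: micro_send)
next
  case (Deliver a m)
  then show ?thesis
    unfolding input_stage_def by (auto intro!: micro_deliver)
qed (auto simp: input_stage_def intro!: micro_activate micro_enter)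

lemma echo_response_may_send:
  "echo_response P now core tip v st = Some m \<Longrightarrow> may_send P core tip v st m"
  unfolding echo_response_def
  by (auto simp: Let_def split: option.splits if_splits prod.splits)

lemma echo_stage_micro:
  "(micro P now core tip i v inp)\<^sup>*\<^sup>* st (echo_stage P now core tip i v st)"
  unfolding echo_stage_def
  by (auto split: option.split intro!: micro_send dest: echo_response_may_send)

lemma ready_stage_micro:
  "(micro P now core tip i v inp)\<^sup>*\<^sup>* st (ready_stage P now i v st)"
proof -
  define B where "B = (SOME B. quorum_size P \<le> card (echo_authors v st B))"
  have B: "quorum_size P \<le> card (echo_authors v st B)"
    if "\<exists>B. quorum_size P \<le> card (echo_authors v st B)"
    using someI_ex[OF that] unfolding B_def .
  have "may_send P core tip v st (Ready v (ready_grade P v st B) B)"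
    if "\<exists>B. quorum_size P \<le> card (echo_authors v st B)" "ready_pending v st"
    using B[OF that(1)] that(2)
    by (auto simp: ready_grade_def ready_pending_def intro!: has_quorumI split: if_splits)
  moreover have "may_send P core tip v st (No_Ready v)" if "ready_pending v st"
    using that by (simp add: ready_pending_def)
  ultimately show ?thesis
    unfolding ready_stage_def Let_def B_def[symmetric]
    by (auto simp del: may_send.simps intro!: micro_send)
qed

text \<open>A refinement presupposes a sent READY-mix. The assumption then excludes an earlier
  no-ready, as the guard of \<open>may_send\<close> demands.\<close>

lemma refine_stage_micro:
  assumes "No_Ready v \<notin> set (sent st) \<or> (\<forall>g B. Ready v g B \<notin> set (sent st))"
  shows "(micro P now core tip i v inp)\<^sup>*\<^sup>* st (refine_stage P now i v st)"
proof -
  obtain g B where gB: "(SOME (g, B). refinable P now v st g B) = (g, B)"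
    by (metis surj_pair)
  have "may_send P core tip v st (Ready v (Hom g) B)" if "\<exists>g B. refinable P now v st g B"
  proof -
    have "refinable P now v st g B"
      using someI_ex[of "\<lambda>(g, B). refinable P now v st g B"] that gB by auto
    moreover have "graded_echo_authors v st g B \<subseteq> echo_authors v st B"
      unfolding graded_echo_authors_def echo_authors_def by blast
    ultimately show ?thesis
      using assms unfolding refinable_def may_send.simps by (metis has_quorumI has_quorum_mono rgrade.inject)
  qed
  then show ?thesis
    unfolding refine_stage_def gB
    by (auto simp del: may_send.simps intro!: micro_send)
qed

lemma complete_stage_micro:
  "(micro P now core tip i v inp)\<^sup>*\<^sup>* st (complete_stage P v st)"
proof -
  have "has_quorum P (ready_authors v st (SOME B. quorum_size P \<le> card (ready_authors v st B)))"
    if "\<exists>B. quorum_size P \<le> card (ready_authors v st B)"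
    using someI_ex[OF that] by (rule has_quorumI)
  then show ?thesis
    unfolding complete_stage_def by (auto intro!: micro_complete)
qed

lemma seal_stage_micro:
  "(micro P now core tip i v inp)\<^sup>*\<^sup>* st (seal_stage P v st)"
proof -
  obtain g B where gB:
    "(SOME (g, B). quorum_size P \<le> card (graded_ready_authors v st g B)) = (g, B)"
    by (metis surj_pair)
  have "has_quorum P (graded_ready_authors v st g B)"
    if "\<exists>g B. quorum_size P \<le> card (graded_ready_authors v st g B)"
    using someI_ex[of "\<lambda>(g, B). quorum_size P \<le> card (graded_ready_authors v st g B)"] that gB
    by (auto intro: has_quorumI)
  then show ?thesis
    unfolding seal_stage_def gB by (auto intro!: micro_seal)
qed

section \<open>Local invariants\<close>

definition extends :: "'m vstate \<Rightarrow> 'm vstate \<Rightarrow> bool" where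
  "extends st st' \<longleftrightarrow>
     (\<forall>x. fixed st = Some x \<longrightarrow> fixed st' = Some x) \<and>
     (\<forall>a x. echo_cnt st a = Some x \<longrightarrow> echo_cnt st' a = Some x) \<and>
     (\<forall>a x. ready_cnt st a = Some x \<longrightarrow> ready_cnt st' a = Some x) \<and>
     (\<forall>a x. refined st a = Some x \<longrightarrow> refined st' a = Some x) \<and>
     set (sent st) \<subseteq> set (sent st')"

lemma extends_refl: "extends st st"
  unfolding extends_def by simp

lemma extends_trans: "extends st st' \<Longrightarrow> extends st' st'' \<Longrightarrow> extends st st''"
  unfolding extends_def by blast

lemma extends_authors:
  assumes "extends st st'"
  shows "echo_authors v st B \<subseteq> echo_authors v st' B"
    "graded_echo_authors v st g B \<subseteq> graded_echo_authors v st' g B"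
    "ready_authors v st B \<subseteq> ready_authors v st' B"
    "graded_ready_authors v st g B \<subseteq> graded_ready_authors v st' g B"
  using assms
  unfolding extends_def echo_authors_def graded_echo_authors_def ready_authors_def
    graded_ready_authors_def by blast+

lemma receive_extends: "extends st (receive P now a m st)"
  by (cases m) (auto simp: extends_def split: rgrade.split)

lemma receive_frame [simp]:
  "sent (receive P now a m st) = sent st"
  "completions (receive P now a m st) = completions st"
  "seals (receive P now a m st) = seals st"
  by (cases m; auto split: rgrade.split)+

lemma broadcast_frame [simp]:
  "sent (broadcast P now i m st) = sent st @ [m]"
  "completions (broadcast P now i m st) = completions st"
  "seals (broadcast P now i m st) = seals st"
  unfolding broadcast_def by simp_all

lemma broadcast_extends: "extends st (broadcast P now i m st)"
  unfolding broadcast_def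
  by (rule extends_trans[OF _ receive_extends]) (auto simp: extends_def)

lemma micro_extends: "micro P now core tip i v inp st st' \<Longrightarrow> extends st st'"
  by (erule micro.cases) (auto simp: receive_extends broadcast_extends, auto simp: extends_def)

definition sent_ok :: "('m, 'x) params \<Rightarrow> view \<Rightarrow> 'm vstate \<Rightarrow> bool" where
  "sent_ok P v st \<longleftrightarrow>
     (\<forall>B B'. Proposal v B \<in> set (sent st) \<longrightarrow> Proposal v B' \<in> set (sent st) \<longrightarrow> B = B') \<and>
     (\<forall>g B. Echo v g B \<in> set (sent st) \<longrightarrow> (\<exists>r. fixed st = Some (B, r))) \<and>
     (\<forall>gr B. Ready v gr B \<in> set (sent st) \<longrightarrow> has_quorum P (echo_authors v st B) \<and>
        (\<forall>g. gr = Hom g \<longrightarrow> has_quorum P (graded_echo_authors v st g B))) \<and>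
     (\<forall>g B. Ready v g B \<in> set (sent st) \<longrightarrow> No_Ready v \<notin> set (sent st))"

definition results_ok :: "('m, 'x) params \<Rightarrow> view \<Rightarrow> 'm vstate \<Rightarrow> bool" where
  "results_ok P v st \<longleftrightarrow>
     length (completions st) \<le> 1 \<and> length (seals st) \<le> 1 \<and>
     (\<forall>B\<in>set (completions st). has_quorum P (ready_authors v st B)) \<and>
     (\<forall>R\<in>set (seals st). \<exists>g B. R = direct_result g B \<and>
        has_quorum P (graded_ready_authors v st g B))"

definition local_inv :: "('m, 'x) params \<Rightarrow> view \<Rightarrow> 'm vstate \<Rightarrow> bool" where
  "local_inv P v st \<longleftrightarrow> sent_ok P v st \<and> results_ok P v st"

lemma extends_quorums:
  assumes "extends st st'"
  shows "has_quorum P (echo_authors v st B) \<Longrightarrow> has_quorum P (echo_authors v st' B)"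
    "has_quorum P (graded_echo_authors v st g B) \<Longrightarrow> has_quorum P (graded_echo_authors v st' g B)"
    "has_quorum P (ready_authors v st B) \<Longrightarrow> has_quorum P (ready_authors v st' B)"
    "has_quorum P (graded_ready_authors v st g B) \<Longrightarrow>
      has_quorum P (graded_ready_authors v st' g B)"
  by (erule has_quorum_mono, rule extends_authors[OF assms])+

lemma sent_okD:
  assumes "sent_ok P v st"
  shows "Proposal v B \<in> set (sent st) \<Longrightarrow> Proposal v B' \<in> set (sent st) \<Longrightarrow> B = B'"
    "Echo v g B \<in> set (sent st) \<Longrightarrow> \<exists>r. fixed st = Some (B, r)"
    "Ready v gr B \<in> set (sent st) \<Longrightarrow> has_quorum P (echo_authors v st B)"
    "Ready v (Hom g) B \<in> set (sent st) \<Longrightarrow> has_quorum P (graded_echo_authors v st g B)"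
    "Ready v gr B \<in> set (sent st) \<Longrightarrow> No_Ready v \<notin> set (sent st)"
  using assms unfolding sent_ok_def by (simp_all, blast)

lemma sent_ok_extends:
  assumes "sent_ok P v st" "extends st st'" "set (sent st') = set (sent st)"
  shows "sent_ok P v st'"
proof -
  have "\<exists>r. fixed st' = Some (B, r)" if "Echo v g B \<in> set (sent st)" for g B
    using sent_okD(2)[OF assms(1) that] assms(2) unfolding extends_def by blast
  then show ?thesis
    unfolding sent_ok_def assms(3)
    by (auto dest: sent_okD(1,3-5)[OF assms(1)] intro: extends_quorums[OF assms(2)])
qed

lemma sent_ok_send:
  assumes "sent_ok P v st" "may_send P core tip v st m" "extends st st'"
    "set (sent st') = insert m (set (sent st))"
  shows "sent_ok P v st'"
proof -
  have fixd: "fixed st = Some x \<Longrightarrow> fixed st' = Some x" for x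
    using assms(3) unfolding extends_def by blast
  then have "\<exists>r. fixed st' = Some (B, r)" if "Echo v g B \<in> set (sent st)" for g B
    using sent_okD(2)[OF assms(1) that] by blast
  with fixd show ?thesis
    using assms(2) unfolding sent_ok_def assms(4)
    by (cases m) (auto dest: sent_okD(1,3-5)[OF assms(1)] intro: extends_quorums[OF assms(3)])
qed

lemma results_ok_extends:
  assumes "results_ok P v st" "extends st st'" "completions st' = completions st" "seals st' = seals st"
  shows "results_ok P v st'"
  unfolding results_ok_def assms(3,4)
proof (intro conjI ballI)
  show "\<exists>g B. R = direct_result g B \<and> has_quorum P (graded_ready_authors v st' g B)"
    if "R \<in> set (seals st)" for R
    using assms(1) that extends_quorums(4)[OF assms(2)] unfolding results_ok_def by meson
  show "has_quorum P (ready_authors v st' B)" if "B \<in> set (completions st)" for B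
    using assms(1) that extends_quorums(3)[OF assms(2)] unfolding results_ok_def by blast
qed (use assms(1) in \<open>simp_all add: results_ok_def\<close>)

lemma micro_local_inv:
  assumes "micro P now core tip i v inp st st'" "local_inv P v st"
  shows "local_inv P v st'"
  using assms(1)
proof (cases rule: micro.cases)
  case (micro_send m)
  then show ?thesis
    using micro_extends[OF assms(1)] assms(2) sent_ok_send[of P v st core tip m st']
      results_ok_extends[of P v st st']
    by (simp add: local_inv_def)
next
  case (micro_complete B)
  then show ?thesis
    using assms(2)
    by (auto simp: local_inv_def sent_ok_def results_ok_def echo_authors_def
        graded_echo_authors_def ready_authors_def graded_ready_authors_def)
next
  case (micro_seal g B)
  then show ?thesis
    using assms(2)
    by (auto simp: local_inv_def sent_ok_def results_ok_def echo_authors_def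
        graded_echo_authors_def ready_authors_def graded_ready_authors_def)
qed (use micro_extends[OF assms(1)] assms(2) in
    \<open>auto simp: local_inv_def intro: sent_ok_extends results_ok_extends\<close>)

lemma micro_rtranclp_local_inv:
  "(micro P now core tip i v inp)\<^sup>*\<^sup>* st st' \<Longrightarrow> local_inv P v st \<Longrightarrow> local_inv P v st'"
  by (induction rule: rtranclp_induct) (auto intro: micro_local_inv)

lemma local_step_micro:
  assumes "local_inv P v st"
  shows "(micro P now core tip i v inp)\<^sup>*\<^sup>* st (local_step P now core tip i v inp st)"
proof -
  \<comment> \<open>The refine stage can be treated only once \<open>sent_ok\<close> is known for
    the state it starts from, so the invariant is first carried through the three stages before
    it.\<close>
  define st3 where "st3 = ready_stage P now i v (echo_stage P now core tip i v
    (input_stage P now i v inp st))"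
  have 3: "(micro P now core tip i v inp)\<^sup>*\<^sup>* st st3"
    unfolding st3_def
    by (meson rtranclp_trans input_stage_micro echo_stage_micro ready_stage_micro)
  then have "sent_ok P v st3" using assms micro_rtranclp_local_inv local_inv_def by blast
  then have "(micro P now core tip i v inp)\<^sup>*\<^sup>* st3 (refine_stage P now i v st3)"
    by (intro refine_stage_micro) (auto simp: sent_ok_def)
  then show ?thesis
    unfolding local_step_def st3_def[symmetric]
    by (meson 3 rtranclp_trans complete_stage_micro seal_stage_micro)
qed

lemma local_inv_init: "local_inv P v init"
  unfolding local_inv_def sent_ok_def results_ok_def init_def by simp

text \<open>The predicate \<open>A a m\<close> stands for receipt of \<open>m\<close> from
  \<open>a\<close> and is later instantiated by \<open>has_received\<close>. The third clause
  prevents a newly counted READY-mix from meeting a refinement grade recorded earlier.\<close>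

definition sourced :: "('m, 'x) params \<Rightarrow> (party \<Rightarrow> 'm msg \<Rightarrow> bool) \<Rightarrow> view \<Rightarrow> 'm vstate \<Rightarrow> bool" where
  "sourced P A v st \<longleftrightarrow>
     (\<forall>a m. echo_cnt st a = Some m \<or> ready_cnt st a = Some m \<longrightarrow> A a m) \<and>
     (\<forall>a B g. ready_cnt st a = Some (Ready v Mix B) \<and> refined st a = Some g \<longrightarrow>
        A a (Ready v (Hom g) B)) \<and>
     (\<forall>a. ready_cnt st a = None \<longrightarrow> refined st a = None) \<and>
     (\<forall>B r. fixed st = Some (B, r) \<longrightarrow> A (proposer P v) (Proposal v B))"

lemma receive_sourced:
  "sourced P A v st \<Longrightarrow> view_of m = v \<Longrightarrow> A a m \<Longrightarrow> sourced P A v (receive P now a m st)"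
  by (cases m) (auto simp: sourced_def split: rgrade.split)

lemma may_send_view: "may_send P core tip v st m \<Longrightarrow> view_of m = v"
  by (cases m) auto

lemma micro_sourced:
  assumes "micro P now core tip i v inp st st'" "sourced P A v st"
    "\<And>m. m \<in> set (sent st') \<Longrightarrow> view_of m = v \<Longrightarrow> A i m"
    "\<And>a m. inp = Deliver a m \<Longrightarrow> view_of m = v \<Longrightarrow> A a m"
  shows "sourced P A v st'"
  using assms(1)
proof (cases rule: micro.cases)
  case (micro_send m)
  have "sourced P A v (st\<lparr>sent := sent st @ [m]\<rparr>)" using assms(2) by (simp add: sourced_def)
  moreover have "A i m" using assms(3) micro_send may_send_view by fastforce
  ultimately show ?thesis
    using micro_send receive_sourced may_send_view unfolding broadcast_def by blast
next
  case (micro_deliver a m)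
  then show ?thesis using assms receive_sourced by blast
qed (use assms(2) in \<open>auto simp: sourced_def\<close>)

lemma micro_rtranclp_extends:
  "(micro P now core tip i v inp)\<^sup>*\<^sup>* st st' \<Longrightarrow> extends st st'"
  by (induction rule: rtranclp_induct) (auto intro: extends_refl extends_trans micro_extends)

lemma micro_rtranclp_sourced:
  assumes "(micro P now core tip i v inp)\<^sup>*\<^sup>* st st'" "sourced P A v st"
    "\<And>m. m \<in> set (sent st') \<Longrightarrow> view_of m = v \<Longrightarrow> A i m"
    "\<And>a m. inp = Deliver a m \<Longrightarrow> view_of m = v \<Longrightarrow> A a m"
  shows "sourced P A v st'"
  using assms
proof (induction rule: rtranclp_induct)
  case (step st' st'')
  have "set (sent st') \<subseteq> set (sent st'')"
    using step(2) micro_extends unfolding extends_def by blast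
  then show ?case using step micro_sourced[of P now core tip i v inp st' st'' A] by blast
qed simp

text \<open>The values \<open>core\<close> and \<open>tip\<close> are parameters of the whole
  sequence, so it does not matter at which transition of the step the ECHO appears.\<close>

lemma micro_rtranclp_echo:
  assumes "(micro P now core tip i v inp)\<^sup>*\<^sup>* st st'" "Echo v g B \<in> set (sent st')"
    "Echo v g B \<notin> set (sent st)"
  shows "core (fst B) \<and> (g = G1 \<longrightarrow> tip (fst B) (snd B))"
  using assms
proof (induction rule: rtranclp_induct)
  case (step st' st'')
  show ?case
    using step(2)
  proof (cases rule: micro.cases)
    case (micro_send m)
    then show ?thesis using step by auto
  qed (use step in auto)
qed simp

section \<open>Invariants of executions\<close>

context
  fixes P :: "('m, 'x) params" and E :: "('m, 'x) execution"
begin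

section \<open>Facts local to one party, without assumptions on the network\<close>

lemma state_Suc_cases:
  obtains "state P E (Suc k) i v = state P E k i v"
  | inp where "event E k = Some (i, inp)"
    "state P E (Suc k) i v =
       local_step P (clock E i k) (coreOK E i k) (tipOK E i k) i v inp (state P E k i v)"
  by (cases "event E k"; cases "fst (the (event E k)) = i") auto

lemma state_local_inv: "local_inv P v (state P E k i v)"
proof (induction k)
  case (Suc k)
  show ?case
    by (rule state_Suc_cases[of k i v])
      (use Suc local_step_micro micro_rtranclp_local_inv in \<open>metis\<close>)+
qed (simp add: local_inv_init)

lemma state_sent_ok: "sent_ok P v (state P E k i v)"
  using state_local_inv unfolding local_inv_def by blast

lemma state_Suc_micro_cases:
  obtains "state P E (Suc k) i v = state P E k i v"
  | inp where "event E k = Some (i, inp)"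
    "(micro P (clock E i k) (coreOK E i k) (tipOK E i k) i v inp)\<^sup>*\<^sup>*
       (state P E k i v) (state P E (Suc k) i v)"
  by (metis state_Suc_cases state_local_inv local_step_micro)

lemma state_extends: "k \<le> k' \<Longrightarrow> extends (state P E k i v) (state P E k' i v)"
proof (induction k' rule: dec_induct)
  case (step k')
  have "extends (state P E k' i v) (state P E (Suc k') i v)"
    by (rule state_Suc_micro_cases[of k' i v]) (auto simp: extends_refl micro_rtranclp_extends)
  then show ?case using step extends_trans by blast
qed (rule extends_refl)

lemma has_sent_mono: "has_sent P E i k m \<Longrightarrow> k \<le> k' \<Longrightarrow> has_sent P E i k' m"
  using state_extends unfolding has_sent_def extends_def by blast

lemma has_received_mono: "has_received P E i k a m \<Longrightarrow> k \<le> k' \<Longrightarrow> has_received P E i k' a m"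
  unfolding has_received_def using has_sent_mono by (meson less_le_trans)

context
  assumes ex: "execution P E"
begin

section \<open>Authenticity of channels and origin of counted statements\<close>

lemma has_received_has_sent:
  assumes "has_received P E i k a m" "correct P a"
  shows "has_sent P E a k m"
  using assms ex has_sent_mono less_imp_le unfolding has_received_def execution_def by metis

lemma has_received_party:
  "correct P i \<Longrightarrow> has_received P E i k a m \<Longrightarrow> a < nparties P"
  using ex unfolding has_received_def execution_def correct_def by blast

lemma state_sourced: "sourced P (has_received P E i k) v (state P E k i v)"
proof (induction k)
  case (Suc k)
  have mono: "has_received P E i k a m \<Longrightarrow> has_received P E i (Suc k) a m" for a m
    using has_received_mono le_SucI by blast
  \<comment> \<open>Index \<open>Suc k\<close> is used from the start of the step: the event at
    index \<open>k\<close> counts as received only below \<open>Suc k\<close>, and messages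
    broadcast in this step are delivered to their sender within it.\<close>
  have old: "sourced P (has_received P E i (Suc k)) v (state P E k i v)"
    using Suc mono unfolding sourced_def by blast
  show ?case
  proof (rule state_Suc_micro_cases[of k i v])
    fix inp
    assume ev: "event E k = Some (i, inp)" and mic: "(micro P (clock E i k) (coreOK E i k)
      (tipOK E i k) i v inp)\<^sup>*\<^sup>* (state P E k i v) (state P E (Suc k) i v)"
    show ?thesis
      using mic old
    proof (rule micro_rtranclp_sourced)
      show "has_received P E i (Suc k) i m"
        if "m \<in> set (sent (state P E (Suc k) i v))" "view_of m = v" for m
        using that unfolding has_received_def has_sent_def by simp
      show "has_received P E i (Suc k) a m" if "inp = Deliver a m" for a m
        using that ev unfolding has_received_def by blast
    qed
  qed (use old in simp)
qed (simp add: sourced_def init_def)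

lemma authors_received:
  "a \<in> echo_authors v (state P E k i v) B \<Longrightarrow> \<exists>g. has_received P E i k a (Echo v g B)"
  "a \<in> graded_echo_authors v (state P E k i v) g B \<Longrightarrow> has_received P E i k a (Echo v g B)"
  "a \<in> ready_authors v (state P E k i v) B \<Longrightarrow> \<exists>gr. has_received P E i k a (Ready v gr B)"
  "a \<in> graded_ready_authors v (state P E k i v) g B \<Longrightarrow>
    has_received P E i k a (Ready v (Hom g) B)"
  "a \<in> no_ready_authors v (state P E k i v) \<Longrightarrow> has_received P E i k a (No_Ready v)"
  using state_sourced[of i k v]
  unfolding sourced_def echo_authors_def graded_echo_authors_def ready_authors_def
    graded_ready_authors_def no_ready_authors_def by blast+

lemma system: "system P"
  using ex unfolding execution_def by blast

lemma authors_bounded: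
  assumes "correct P i"
  shows "echo_authors v (state P E k i v) B \<subseteq> {..<nparties P}"
    "graded_echo_authors v (state P E k i v) g B \<subseteq> {..<nparties P}"
    "ready_authors v (state P E k i v) B \<subseteq> {..<nparties P}"
    "graded_ready_authors v (state P E k i v) g B \<subseteq> {..<nparties P}"
    "no_ready_authors v (state P E k i v) \<subseteq> {..<nparties P}"
  using authors_received[where i = i and k = k and v = v] has_received_party[OF assms]
  by (meson lessThan_iff subsetI)+

lemma correct_author_sent:
  assumes "correct P a"
  shows "a \<in> echo_authors v (state P E k i v) B \<Longrightarrow> \<exists>g. has_sent P E a k (Echo v g B)"
    "a \<in> graded_echo_authors v (state P E k i v) g B \<Longrightarrow> has_sent P E a k (Echo v g B)"
    "a \<in> ready_authors v (state P E k i v) B \<Longrightarrow> \<exists>gr. has_sent P E a k (Ready v gr B)"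
    "a \<in> graded_ready_authors v (state P E k i v) g B \<Longrightarrow>
      has_sent P E a k (Ready v (Hom g) B)"
    "a \<in> no_ready_authors v (state P E k i v) \<Longrightarrow> has_sent P E a k (No_Ready v)"
  using authors_received[where i = i and k = k and v = v] has_received_has_sent[OF _ assms]
  by meson+

lemma has_sent_Ready:
  "has_sent P E a k (Ready v gr B) \<Longrightarrow> has_quorum P (echo_authors v (state P E k a v) B)"
  "has_sent P E a k (Ready v (Hom g) B) \<Longrightarrow>
    has_quorum P (graded_echo_authors v (state P E k a v) g B)"
  unfolding has_sent_def by (simp_all add: sent_okD(3,4)[OF state_sent_ok])

lemma has_sent_Echo:
  assumes "has_sent P E a k (Echo v g B)"
  shows "has_received P E a k (proposer P v) (Proposal v B)"
  using assms state_local_inv[of v k a] state_sourced[of a k v]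
  unfolding local_inv_def sent_ok_def has_sent_def sourced_def by auto

text \<open>Sent messages persist, so two of them can be judged by \<open>sent_ok\<close> in one
  common later state.\<close>

lemma has_sent_max:
  assumes "has_sent P E a k m" "has_sent P E a k' m'"
  obtains K where "has_sent P E a K m" "has_sent P E a K m'"
  using assms has_sent_mono that by (meson max.cobounded1 max.cobounded2)

section \<open>Uniqueness of echoed values and of grades\<close>

lemma has_sent_Echo_unique:
  assumes "has_sent P E a k (Echo v g B)" "has_sent P E a k' (Echo v g' B')"
  shows "B = B'"
proof -
  obtain K where "has_sent P E a K (Echo v g B)" "has_sent P E a K (Echo v g' B')"
    using assms has_sent_max by blast
  then show ?thesis
    using sent_okD(2)[OF state_sent_ok, of v g B K a] sent_okD(2)[OF state_sent_ok, of v g' B' K a]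
    unfolding has_sent_def by auto
qed

lemma has_sent_Proposal_unique:
  assumes "has_sent P E a k (Proposal v B)" "has_sent P E a k' (Proposal v B')"
  shows "B = B'"
proof -
  obtain K where "has_sent P E a K (Proposal v B)" "has_sent P E a K (Proposal v B')"
    using assms has_sent_max by blast
  then show ?thesis
    using sent_okD(1)[OF state_sent_ok, of v B K a B'] unfolding has_sent_def by simp
qed

lemma echo_quorums_agree:
  assumes "correct P i" "correct P i'"
    "has_quorum P (echo_authors v (state P E k i v) B)"
    "has_quorum P (echo_authors v (state P E k' i' v) B')"
  shows "B = B'"
proof -
  obtain a where "correct P a" "a \<in> echo_authors v (state P E k i v) B"
    "a \<in> echo_authors v (state P E k' i' v) B'"
    using quorums_share_correct[OF system assms(3,4) authors_bounded(1)[OF assms(1)]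
        authors_bounded(1)[OF assms(2)]] by metis
  then show ?thesis using correct_author_sent(1) has_sent_Echo_unique by metis
qed

lemma Hom_Ready_grade_unique:
  assumes "correct P a" "has_sent P E a k (Ready v (Hom g) B)"
    "has_sent P E a k' (Ready v (Hom g') B')"
  shows "g = g'"
proof -
  obtain K where K: "has_sent P E a K (Ready v (Hom g) B)" "has_sent P E a K (Ready v (Hom g') B')"
    using assms(2,3) has_sent_max by blast
  \<comment> \<open>Both ECHO quorums are read off the same state of \<open>a\<close>, where
    \<open>echo_cnt\<close> holds a single statement for their common author
    \<open>x\<close>.\<close>
  obtain x where "x \<in> graded_echo_authors v (state P E K a v) g B"
    "x \<in> graded_echo_authors v (state P E K a v) g' B'"
    using quorums_share_correct[OF system has_sent_Ready(2)[OF K(1)] has_sent_Ready(2)[OF K(2)]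
        authors_bounded(2)[OF assms(1)] authors_bounded(2)[OF assms(1)]] by metis
  then show ?thesis unfolding graded_echo_authors_def by simp
qed

section \<open>From quorums back to correct senders\<close>

lemma ready_quorum_sender:
  assumes "correct P i" "has_quorum P (ready_authors v (state P E k i v) B)"
  obtains a gr where "correct P a" "has_sent P E a k (Ready v gr B)"
  using quorums_share_correct[OF system assms(2) assms(2) authors_bounded(3)[OF assms(1)] authors_bounded(3)[OF assms(1)]]
    correct_author_sent(3) by metis

lemma graded_ready_quorum_sender:
  assumes "correct P i" "has_quorum P (graded_ready_authors v (state P E k i v) g B)"
  obtains a where "correct P a" "has_sent P E a k (Ready v (Hom g) B)"
  using quorums_share_correct[OF system assms(2) assms(2) authors_bounded(4)[OF assms(1)] authors_bounded(4)[OF assms(1)]]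
    correct_author_sent(4) by metis

lemma echo_quorum_sender:
  assumes "correct P i" "has_quorum P (echo_authors v (state P E k i v) B)"
  obtains a g where "correct P a" "has_sent P E a k (Echo v g B)"
  using quorums_share_correct[OF system assms(2) assms(2) authors_bounded(1)[OF assms(1)] authors_bounded(1)[OF assms(1)]]
    correct_author_sent(1) by metis

lemma graded_echo_quorum_sender:
  assumes "correct P i" "has_quorum P (graded_echo_authors v (state P E k i v) g B)"
  obtains a where "correct P a" "has_sent P E a k (Echo v g B)"
  using quorums_share_correct[OF system assms(2) assms(2) authors_bounded(2)[OF assms(1)] authors_bounded(2)[OF assms(1)]]
    correct_author_sent(2) by metis

lemma completion_quorum:
  "B \<in> set (completions (state P E k i v)) \<Longrightarrow> has_quorum P (ready_authors v (state P E k i v) B)"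
  using state_local_inv[of v k i] unfolding local_inv_def results_ok_def by blast

lemma seal_quorum:
  assumes "R \<in> set (seals (state P E k i v))"
  obtains g B where "R = direct_result g B" "has_quorum P (graded_ready_authors v (state P E k i v) g B)"
  using assms state_local_inv[of v k i] unfolding local_inv_def results_ok_def by blast

lemma ready_quorum_echo_quorum:
  assumes "correct P i" "has_quorum P (ready_authors v (state P E k i v) B)"
  obtains a where "correct P a" "has_quorum P (echo_authors v (state P E k a v) B)"
  using ready_quorum_sender[OF assms] has_sent_Ready(1) by metis

text \<open>The chain runs from the counted READYs to a correct READY sender, from there to the ECHO
  quorum in the state of that sender, and on to a correct member of it.\<close>

lemma completion_echoer:
  assumes "correct P i" "B \<in> set (completions (state P E k i v))"
  obtains a g where "correct P a" "has_sent P E a k (Echo v g B)"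
  using ready_quorum_echo_quorum[OF assms(1) completion_quorum[OF assms(2)]] echo_quorum_sender
  by metis

text \<open>The grade survives the way back because a homogeneous READY rests on ECHOs of exactly
  its grade. For grade 1 this reaches a correct party that evaluated TipOK.\<close>

lemma graded_ready_quorum_echoer:
  assumes "correct P i" "has_quorum P (graded_ready_authors v (state P E k i v) g B)"
  obtains a where "correct P a" "has_sent P E a k (Echo v g B)"
  using graded_ready_quorum_sender[OF assms] has_sent_Ready(2) graded_echo_quorum_sender by metis

text \<open>READYs, READY quorums and completions all reduce to an ECHO quorum at some correct
  party, and any two of those name the same proposal.\<close>

lemma value_agreement:
  "\<exists>Bv. \<forall>i k B. correct P i \<longrightarrow>
        (\<exists>g. has_sent P E i k (Ready v g B)) \<or>
        ready_quorum P v (state P E k i v) B \<or>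
        B \<in> set (completions (state P E k i v)) \<longrightarrow>
        B = Bv \<and> (\<exists>j. correct P j \<and> has_received P E j k (proposer P v) (Proposal v Bv))"
proof -
  let ?H = "\<lambda>i k B. correct P i \<and> ((\<exists>g. has_sent P E i k (Ready v g B)) \<or>
        ready_quorum P v (state P E k i v) B \<or> B \<in> set (completions (state P E k i v)))"
  have H: "\<exists>a. correct P a \<and> has_quorum P (echo_authors v (state P E k a v) B)" if "?H i k B" for i k B
    using that has_sent_Ready(1) ready_quorum_echo_quorum completion_quorum
    unfolding ready_quorum_iff by metis
  have uniq: "B = B'" if "?H i k B" "?H i' k' B'" for i k B i' k' B'
    using H[OF that(1)] H[OF that(2)] echo_quorums_agree by blast
  have recv: "\<exists>j. correct P j \<and> has_received P E j k (proposer P v) (Proposal v B)"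
    if "?H i k B" for i k B
    using H[OF that] echo_quorum_sender has_sent_Echo by metis
  show ?thesis
  \<comment> \<open>\<open>Bv\<close> is chosen before the parties and times: any named proposal
    will do if there is one, and otherwise the claim is vacuous.\<close>
  proof (cases "\<exists>i k B. ?H i k B")
    case True
    then obtain i0 k0 B0 where 0: "?H i0 k0 B0" by blast
    show ?thesis
    proof (rule exI[of _ B0], intro allI impI)
      fix i k B
      assume "correct P i" "(\<exists>g. has_sent P E i k (Ready v g B)) \<or>
        ready_quorum P v (state P E k i v) B \<or> B \<in> set (completions (state P E k i v))"
      then have "?H i k B" by blast
      then show "B = B0 \<and> (\<exists>j. correct P j \<and> has_received P E j k (proposer P v) (Proposal v B0))"
        using uniq[OF _ 0] recv by blast
    qed
  qed blast
qed

lemma correct_proposer_echo: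
  assumes "correct P (proposer P v)" "has_sent P E (proposer P v) k0 (Proposal v B)"
    "has_sent P E a k (Echo v g B')"
  shows "B' = B"
  using assms has_sent_Echo has_received_has_sent has_sent_Proposal_unique by meson

lemma seal_echoer:
  assumes "correct P i" "R \<in> set (seals (state P E k i v))"
  obtains a g B where "R = direct_result g B" "correct P a" "has_sent P E a k (Echo v g B)"
  using seal_quorum[OF assms(2)] graded_ready_quorum_echoer[OF assms(1)] by metis

lemma graded_ready_quorums_agree:
  assumes "correct P i" "correct P i'"
    "has_quorum P (graded_ready_authors v (state P E k i v) g B)"
    "has_quorum P (graded_ready_authors v (state P E k' i' v) g' B')"
  shows "g = g'"
proof -
  obtain a where "correct P a" "a \<in> graded_ready_authors v (state P E k i v) g B"
    "a \<in> graded_ready_authors v (state P E k' i' v) g' B'"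
    using quorums_share_correct[OF system assms(3,4) authors_bounded(4)[OF assms(1)]
        authors_bounded(4)[OF assms(2)]] by metis
  then show ?thesis using correct_author_sent(4) Hom_Ready_grade_unique by metis
qed

text \<open>The constructor of a result reveals the grade of its quorum, whatever the manifests
  are.\<close>

lemma seals_not_conflicting:
  assumes "correct P i" "correct P i'" "Commit_Full C T \<in> set (seals (state P E k i v))"
    "Commit_Core C' \<in> set (seals (state P E k' i' v))"
  shows False
proof -
  obtain g B where 1: "Commit_Full C T = direct_result g B"
    "has_quorum P (graded_ready_authors v (state P E k i v) g B)"
    using seal_quorum[OF assms(3)] .
  obtain g' B' where 2: "Commit_Core C' = direct_result g' B'"
    "has_quorum P (graded_ready_authors v (state P E k' i' v) g' B')"
    using seal_quorum[OF assms(4)] .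
  have "g = g'" using graded_ready_quorums_agree[OF assms(1,2) 1(2) 2(2)] .
  with 1(1) 2(1) show False by (cases g; cases B; cases B') auto
qed

text \<open>A correct author in both quorums would have sent a READY and a no-ready. Whichever came
  first blocks the other, and a refinement is blocked as well.\<close>

lemma ready_no_ready_exclusive:
  assumes "correct P i" "correct P i'" "has_quorum P (ready_authors v (state P E k i v) B)"
    "has_quorum P (no_ready_authors v (state P E k' i' v))"
  shows False
proof -
  obtain a where "correct P a" "a \<in> ready_authors v (state P E k i v) B"
    "a \<in> no_ready_authors v (state P E k' i' v)"
    using quorums_share_correct[OF system assms(3,4) authors_bounded(3)[OF assms(1)]
        authors_bounded(5)[OF assms(2)]] by metis
  then obtain gr where "has_sent P E a k (Ready v gr B)" "has_sent P E a k' (No_Ready v)"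
    using correct_author_sent(3,5) by metis
  then obtain K where "has_sent P E a K (Ready v gr B)" "has_sent P E a K (No_Ready v)"
    using has_sent_max by blast
  then show False
    using sent_okD(5)[OF state_sent_ok, of v gr B K a] unfolding has_sent_def by simp
qed

text \<open>This isolates the step of first appearance: the local predicates are known to hold
  there, and it is also the step for which the Vantage rules promise retention.\<close>

lemma echo_step:
  assumes "has_sent P E a k (Echo v g B)"
  obtains k0 where "k0 < k" "\<not> has_sent P E a k0 (Echo v g B)" "has_sent P E a (Suc k0) (Echo v g B)"
    "coreOK E a k0 (fst B)" "g = G1 \<Longrightarrow> tipOK E a k0 (fst B) (snd B)"
proof -
  have "\<not> has_sent P E a 0 (Echo v g B)" unfolding has_sent_def by (simp add: init_def)
  then obtain k0 where k0: "k0 < k" "\<not> has_sent P E a k0 (Echo v g B)"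
    "has_sent P E a (Suc k0) (Echo v g B)"
    using ex_least_nat_less[of "\<lambda>k. has_sent P E a k (Echo v g B)" k] assms by blast
  show ?thesis
  proof (rule state_Suc_micro_cases[of k0 a v])
    fix inp
    assume "(micro P (clock E a k0) (coreOK E a k0) (tipOK E a k0) a v inp)\<^sup>*\<^sup>*
       (state P E k0 a v) (state P E (Suc k0) a v)"
    then show ?thesis
      using micro_rtranclp_echo k0 that unfolding has_sent_def by fastforce
  qed (use k0 in \<open>auto simp: has_sent_def\<close>)
qed

lemma echo_witnessed:
  assumes "eligibility_contract P E" "correct P a" "has_sent P E a k (Echo v g B)"
  shows "witnessed P E k (fst B)" "g = G1 \<Longrightarrow> witnessed P E k (snd B)"
proof -
  obtain k0 where k0: "k0 < k" "coreOK E a k0 (fst B)" "g = G1 \<Longrightarrow> tipOK E a k0 (fst B) (snd B)"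
    using echo_step[OF assms(3)] by metis
  have later: "witnessed P E k M" if "witnessed P E k0 M" for M
    using that k0(1) unfolding witnessed_def by auto
  show "witnessed P E k (fst B)" "g = G1 \<Longrightarrow> witnessed P E k (snd B)"
    using assms(1,2) k0(2,3) later unfolding eligibility_contract_def by blast+
qed

end

end

section \<open>Lanes\<close>

text \<open>The chain is read backwards: the reference fixes the hash of the last block, and each
  block fixes the hash of its predecessor. Injectivity turns equal hashes into equal blocks.\<close>

lemma names_unique:
  assumes "inj (hash V)" "names V r bs" "names V r bs'"
  shows "bs = bs'"
proof -
  obtain a h x where r: "r = (a, h, x)" by (cases r)
  have len: "length bs = h" "length bs' = h" "0 < h"
    using assms(2,3) unfolding r by auto
  have "bs ! (h - 1 - d) = bs' ! (h - 1 - d)" for d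
  proof (induction d)
    case 0
    have "hash V (last bs) = hash V (last bs')" using assms(2,3) unfolding r by auto
    then show ?case using assms(1) len by (metis diff_zero injD last_conv_nth length_0_conv less_irrefl)
  next
    case (Suc d)
    show ?case
    proof (cases "h - 1 - d = 0")
      \<comment> \<open>At the first block the subtraction on naturals stays at 0, so the index does
        not move.\<close>
      case True
      then show ?thesis using Suc by simp
    next
      case False
      then have l: "h - 1 - d < h" "h - 1 - Suc d = h - 1 - d - 1" using len by auto
      have "lane_chain V a bs" "lane_chain V a bs'"
        using assms(2,3) unfolding r by (auto simp: valid_prefix_def)
      then have "pred_hash (bs ! (h - 1 - d)) = hash V (bs ! (h - 1 - d - 1))"
        "pred_hash (bs' ! (h - 1 - d)) = hash V (bs' ! (h - 1 - d - 1))"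
        using l(1) False len unfolding lane_chain_def by simp_all
      then show ?thesis using Suc l(2) assms(1) by (metis injD)
    qed
  qed
  note eq = this
  have "bs ! l = bs' ! l" if "l < h" for l
    using eq[of "h - 1 - l"] that by simp
  then show ?thesis using len by (simp add: nth_equalityI)
qed

text \<open>One party and one prefix per reference suffice: if the hash is injective, every prefix
  named by the reference is that one.\<close>

lemma lanes_witnessedI:
  assumes "\<And>r. r \<in> set (entries V M) \<Longrightarrow>
    \<exists>j bs. correct P j \<and> names V r bs \<and> keeps V j k bs \<and> (\<forall>b\<in>set bs. (fst r, b) \<in> pub_recv V j k)"
  shows "lanes_witnessed P V k M"
  using assms names_unique
  unfolding lanes_witnessed_def author_backed_def prefix_retrievable_def by metis

lemma vantage_executionD:
  assumes "vantage_execution P E V"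
  shows "execution P E"
    "correct P i \<Longrightarrow> mono (pub_recv V i)"
    "correct P i \<Longrightarrow> (a, r) \<in> ack_recv V i k \<Longrightarrow> a < nparties P"
    "correct P i \<Longrightarrow> (a, r) \<in> ack_recv V i k \<Longrightarrow> correct P a \<Longrightarrow> r \<in> ack_sent V a k"
    "correct P i \<Longrightarrow> r \<in> ack_sent V i k \<Longrightarrow>
      \<exists>k'\<le>k. \<exists>bs. direct_pub_by V i k' r bs \<and> keeps V i k' bs"
    "correct P i \<Longrightarrow> has_sent P E i (Suc k) (Echo v g B) \<Longrightarrow>
      \<not> has_sent P E i k (Echo v g B) \<Longrightarrow> relies_on V i k g B bs \<Longrightarrow> keeps V i k bs"
    "correct P i \<Longrightarrow> coreOK E i k C = author_ok P V i k C"
    "correct P i \<Longrightarrow> tipOK E i k C T = (author_ok P V i k T \<and> tip_extends V i k C T)"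
  by (insert assms[unfolded vantage_execution_def], elim conjE, meson)+

text \<open>Either \<open>j\<close> has DirectPub itself and retains the prefix by
  \<open>keep\<close>, or one of the f + 1 acknowledgers is correct, and it had DirectPub and
  retains the prefix. Receipts and retention carry over from \<open>k0\<close> to
  \<open>k\<close>.\<close>

lemma author_ok_backed:
  assumes ve: "vantage_execution P E V" and ok: "author_ok P V j k0 M" "k0 \<le> k" "correct P j"
    and keep: "\<And>r bs. r \<in> set (entries V M) \<Longrightarrow> direct_pub_by V j k0 r bs \<Longrightarrow> keeps V j k0 bs"
  shows "lanes_witnessed P V k M"
proof (rule lanes_witnessedI)
  fix r assume r: "r \<in> set (entries V M)"
  have backed: "\<exists>j bs. correct P j \<and> names V r bs \<and> keeps V j k bs \<and>
      (\<forall>b\<in>set bs. (fst r, b) \<in> pub_recv V j k)"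
    if "correct P a" "direct_pub_by V a k' r bs" "keeps V a k' bs" "k' \<le> k" for a k' bs
  proof -
    have "pub_recv V a k' \<subseteq> pub_recv V a k"
      using vantage_executionD(2)[OF ve that(1)] that(4) by (rule monoD)
    then show ?thesis
      using that unfolding direct_pub_by_def keeps_def by (meson order_trans subsetD)
  qed
  show "\<exists>j bs. correct P j \<and> names V r bs \<and> keeps V j k bs \<and>
      (\<forall>b\<in>set bs. (fst r, b) \<in> pub_recv V j k)"
  proof (cases "direct_pub V j k0 r")
    case True
    then show ?thesis using backed keep r ok unfolding direct_pub_def by blast
  next
    case False
    let ?A = "{a. (a, r) \<in> ack_recv V j k0}"
    have "nfaulty P + 1 \<le> card ?A" using ok(1) r False unfolding author_ok_def by blast
    moreover have "finite (byzantine P)" "card (byzantine P) \<le> nfaulty P"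
      using system[OF vantage_executionD(1)[OF ve]] finite_subset unfolding system_def by blast+
    ultimately have "\<not> ?A \<subseteq> byzantine P" using card_mono[of "byzantine P" ?A] by linarith
    then obtain a where a: "(a, r) \<in> ack_recv V j k0" "a \<notin> byzantine P" by blast
    have "correct P a"
      using vantage_executionD(3)[OF ve ok(3) a(1)] a(2) unfolding correct_def by blast
    moreover from this obtain k' bs where "k' \<le> k0" "direct_pub_by V a k' r bs" "keeps V a k' bs"
      using vantage_executionD(4)[OF ve ok(3) a(1)] vantage_executionD(5)[OF ve] by blast
    ultimately show ?thesis using backed[of a k' bs] ok(2) by simp
  qed
qed

lemma echo_lanes_witnessed:
  assumes ve: "vantage_execution P E V" and a: "correct P a" "has_sent P E a k (Echo v g (C, T))"
  shows "lanes_witnessed P V k C" "g = G1 \<Longrightarrow> lanes_witnessed P V k T"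
proof -
  obtain k0 where k0: "k0 < k" "\<not> has_sent P E a k0 (Echo v g (C, T))"
    "has_sent P E a (Suc k0) (Echo v g (C, T))"
    "coreOK E a k0 C" "g = G1 \<Longrightarrow> tipOK E a k0 C T"
    using echo_step[OF vantage_executionD(1)[OF ve] a(2)] by (metis fst_conv snd_conv)
  note keep = vantage_executionD(6)[OF ve a(1) k0(3,2)]
  have core: "author_ok P V a k0 C" and tip: "g = G1 \<Longrightarrow> author_ok P V a k0 T"
    using vantage_executionD(7,8)[OF ve a(1)] k0(4,5) by simp_all
  show "lanes_witnessed P V k C"
    by (rule author_ok_backed[OF ve core less_imp_le[OF k0(1)] a(1)], rule keep)
      (auto simp: relies_on_def)
  show "lanes_witnessed P V k T" if "g = G1"
    by (rule author_ok_backed[OF ve tip[OF that] less_imp_le[OF k0(1)] a(1)], rule keep)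
      (use that in \<open>auto simp: relies_on_def\<close>)
qed

section \<open>A run with a sealed, an open and an incomplete party\<close>

text \<open>Exactly f parties are Byzantine, so the correct ones form a single quorum and leaving
  out one of them costs a seal. The proposer is Byzantine: its proposal then requires no
  \<open>Propose\<close> event, and the same party can send the READY-mix. With empty
  \<open>items\<close> every manifest is witnessed.\<close>

locale split_run =
  fixes n f :: nat and v :: view and g :: grade and C T :: 'm and P :: "('m, 'x) params"
  assumes f_pos: "1 \<le> f" and resilience: "3 * f + 1 \<le> n"
    and P_eq: "P = \<lparr>nparties = n, nfaulty = f, byzantine = {n - f..<n}, proposer = (\<lambda>_. n - 1),
      formed = (\<lambda>_ _. True), Delta = 1, items = (\<lambda>_. []), ext_valid = (\<lambda>_. True)\<rparr>"
begin

abbreviation "Q \<equiv> n - f"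
abbreviation "B \<equiv> (C, T)"

lemma Q_bounds: "3 \<le> Q" "Q < n"
  using f_pos resilience by linarith+

definition byz :: party where
  "byz = n - 1"

lemma byz_bounds: "byz < n" "Q \<le> byz"
  using f_pos resilience unfolding byz_def by linarith+

lemma not_n_le_f [simp]: "\<not> n \<le> f"
  using resilience by linarith

lemma P_simps [simp]:
  "nparties P = n" "nfaulty P = f" "proposer P w = byz" "formed P w B'"
  "quorum_size P = Q" "theta_E P = 3" "theta_R P = 4" "Delta P = 1" "items P M = []"
  "correct P i \<longleftrightarrow> i < Q"
  unfolding P_eq byz_def quorum_size_def theta_E_def theta_R_def correct_def by auto

lemma system_P: "system P"
  using resilience unfolding system_def by (auto simp: P_eq)

abbreviation "echo \<equiv> Echo v g B"
abbreviation "ready \<equiv> Ready v (Hom g) B"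

text \<open>The tip predicate is false at time 0, so that the echo waits until the deadline 1 for both
  grades.\<close>

definition step :: "party \<Rightarrow> view \<Rightarrow> real \<Rightarrow> 'm input \<Rightarrow> 'm vstate \<Rightarrow> 'm vstate" where
  "step p w t inp st = local_step P t (\<lambda>_. True) (\<lambda>_ _. g = G1 \<and> 0 < t) p w inp st"

text \<open>Each party is simulated alone. Parties influence each other only through deliveries,
  which the schedule lists explicitly; that delivered messages were really sent is checked
  afterwards.\<close>

definition run ::
    "party \<Rightarrow> view \<Rightarrow> (real \<times> party \<times> 'm input) list \<Rightarrow> 'm vstate \<Rightarrow> 'm vstate" where
  "run p w xs st =
     foldl (\<lambda>st (t, q, inp). if q = p then step p w t inp st else st) st xs"

lemma run_simps [simp]:
  "run p w [] st = st"
  "run p w ((t, q, inp) # xs) st = run p w xs (if q = p then step p w t inp st else st)"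
  "run p w (xs @ ys) st = run p w ys (run p w xs st)"
  unfolding run_def by simp_all

lemma run_other: "(\<And>e. e \<in> set xs \<Longrightarrow> fst (snd e) \<noteq> p) \<Longrightarrow> run p w xs st = st"
proof (induction xs)
  case (Cons e xs)
  then show ?case by (cases e) force
qed simp

text \<open>Phases are concatenations of one block per party, so a party sees only its own block of
  each phase.\<close>

lemma run_blocks:
  assumes "distinct ps" "\<And>q e. e \<in> set (block q) \<Longrightarrow> fst (snd e) = q"
  shows "run p w (concat (map block ps)) st = (if p \<in> set ps then run p w (block p) st else st)"
  using assms(1)
proof (induction ps arbitrary: st)
  case (Cons q ps)
  have "run p w (block q) st = st" if "q \<noteq> p" for st
    using run_other assms(2) that by metis
  then show ?case using Cons by (cases "q = p") simp_all
qed simp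

subsection \<open>Local states\<close>

definition before_echo :: "'m vstate" where
  "before_echo = init\<lparr>fixed := Some (B, 0), entry := Some 0\<rparr>"

definition counting ::
    "party set \<Rightarrow> party set \<Rightarrow> party set \<Rightarrow> 'm msg list \<Rightarrow> 'm proposal list \<Rightarrow> 'm result list
      \<Rightarrow> 'm vstate" where
  "counting A R M s c l = before_echo\<lparr>
     echo_cnt := (\<lambda>a. if a \<in> A then Some echo else None),
     ready_cnt := (\<lambda>a. if a \<in> R then Some ready else if a \<in> M then Some (Ready v Mix B) else None),
     sent := s, completions := c, seals := l\<rparr>"

section \<open>Effect of the single stages on counting states\<close>

lemma counting_simps [simp]:
  "fixed (counting A R M s c l) = Some (B, 0)" "entry (counting A R M s c l) = Some 0"
  "sent (counting A R M s c l) = s" "completions (counting A R M s c l) = c"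
  "seals (counting A R M s c l) = l" "refined (counting A R M s c l) = (\<lambda>_. None)"
  unfolding counting_def before_echo_def by (simp_all add: init_def)

lemma counting_updates:
  "(counting A R M s c l)\<lparr>completions := c'\<rparr> = counting A R M s c' l"
  "(counting A R M s c l)\<lparr>seals := l'\<rparr> = counting A R M s c l'"
  "(counting A R M s c l)\<lparr>sent := s'\<rparr> = counting A R M s' c l"
  unfolding counting_def by simp_all

lemma counting_authors [simp]:
  "echo_authors v (counting A R M s c l) B' = (if B' = B then A else {})"
  "graded_echo_authors v (counting A R M s c l) g' B' = (if g' = g \<and> B' = B then A else {})"
  "R \<inter> M = {} \<Longrightarrow> ready_authors v (counting A R M s c l) B' = (if B' = B then R \<union> M else {})"
  "graded_ready_authors v (counting A R M s c l) g' B' = (if g' = g \<and> B' = B then R else {})"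
  unfolding counting_def echo_authors_def graded_echo_authors_def ready_authors_def
    graded_ready_authors_def before_echo_def by (auto simp: init_def split: if_splits)

lemma receive_counting:
  "receive P t q echo (counting A R M s c l) = counting (insert q A) R M s c l"
  "q \<notin> M \<Longrightarrow> receive P t q ready (counting A R M s c l) = counting A (insert q R) M s c l"
  "q \<notin> R \<Longrightarrow> q \<notin> M \<Longrightarrow> receive P t q (Ready v Mix B) (counting A R M s c l) =
     counting A R (insert q M) s c l"
  unfolding counting_def before_echo_def
  by (auto simp: init_def fun_eq_iff split: if_splits intro!: arg_cong2[where f = ready_cnt_update]
      arg_cong2[where f = echo_cnt_update])

lemma echo_stage_counting:
  "echo \<in> set s \<Longrightarrow> echo_stage P t core tip p v (counting A R M s c l) = counting A R M s c l"
  unfolding echo_stage_def echo_pending_def by auto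

lemma refine_stage_counting:
  "Ready v Mix B \<notin> set s \<Longrightarrow> refine_stage P t p v (counting A R M s c l) = counting A R M s c l"
  using Q_bounds unfolding refine_stage_def refinable_def by auto

lemma complete_stage_counting:
  assumes "R \<inter> M = {}" "c = [] \<or> c = [B] \<and> Q \<le> card (R \<union> M)"
  shows "complete_stage P v (counting A R M s c l) =
    counting A R M s (if Q \<le> card (R \<union> M) then [B] else []) l"
proof -
  have some: "(SOME B'. Q \<le> card (if B' = B then R \<union> M else {})) = B" if "Q \<le> card (R \<union> M)"
    using that Q_bounds by (intro some_equality) (auto split: if_splits)
  show ?thesis
    unfolding complete_stage_def using assms Q_bounds some
    by (auto simp: counting_updates simp del: split_paired_Ex split: if_splits)
qed

lemma seal_stage_counting:
  assumes "l = [] \<or> l = [direct_result g B] \<and> Q \<le> card R"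
  shows "seal_stage P v (counting A R M s c l) =
    counting A R M s c (if Q \<le> card R then [direct_result g B] else [])"
proof -
  have some: "(SOME (g', B'). Q \<le> card (if g' = g \<and> B' = B then R else {})) = (g, B)"
    if "Q \<le> card R"
    using that Q_bounds by (intro some_equality) (auto split: if_splits)
  show ?thesis
    unfolding seal_stage_def using assms Q_bounds some
    by (auto simp: counting_updates simp del: split_paired_Ex split: if_splits)
qed

lemma ready_stage_counting_sent:
  "ready \<in> set s \<Longrightarrow> ready_stage P t p v (counting A R M s c l) = counting A R M s c l"
  unfolding ready_stage_def ready_pending_def by auto

lemma ready_stage_counting_few:
  "card A < Q \<Longrightarrow> t < 4 \<Longrightarrow> ready_stage P t p v (counting A R M s c l) = counting A R M s c l"
  using Q_bounds unfolding ready_stage_def by (auto split: if_splits)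

lemma ready_stage_counting_quorum:
  assumes "Q \<le> card A" "t < 4" "s = [echo]" "p \<notin> M"
  shows "ready_stage P t p v (counting A R M s c l) = counting A (insert p R) M [echo, ready] c l"
proof -
  have some: "(SOME B'. Q \<le> card (if B' = B then A else {})) = B"
    using assms Q_bounds by (intro some_equality) (auto split: if_splits)
  have pending: "ready_pending v (counting A R M s c l)"
    using assms(3) by (simp add: ready_pending_def)
  have grade: "ready_grade P v (counting A R M s c l) B = Hom g"
  proof -
    define st where "st = counting A R M s c l"
    have "Q \<le> card (graded_echo_authors v st g' B) \<longleftrightarrow> g' = g" for g'
      using assms(1) Q_bounds unfolding st_def by simp
    then show ?thesis unfolding st_def[symmetric] by (cases g) (simp_all add: ready_grade_def)
  qed
  have ex: "\<exists>B'. Q \<le> card (if B' = B then A else {})" using assms(1) by (intro exI[of _ B]) simp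
  show ?thesis
    unfolding ready_stage_def using assms Q_bounds pending some grade ex
    by (simp add: Let_def broadcast_def counting_updates receive_counting del: receive.simps)
qed

text \<open>The READY leaves in the very step that counts the ECHO number Q, hence the case
  distinction. The own READY alone completes nothing since Q is at least 3.\<close>

definition echoing :: "party \<Rightarrow> party set \<Rightarrow> 'm vstate" where
  "echoing p A = counting A (if Q \<le> card A then {p} else {}) {}
     (if Q \<le> card A then [echo, ready] else [echo]) [] []"

definition readying :: "party set \<Rightarrow> party set \<Rightarrow> 'm vstate" where
  "readying R M = counting {..<Q} R M [echo, ready]
     (if Q \<le> card (R \<union> M) then [B] else []) (if Q \<le> card R then [direct_result g B] else [])"

lemma echoing_readying: "echoing p {..<Q} = readying {p} {}"
  using Q_bounds unfolding echoing_def readying_def by simp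

section \<open>Effect of whole steps\<close>

definition stages :: "party \<Rightarrow> view \<Rightarrow> real \<Rightarrow> 'm vstate \<Rightarrow> 'm vstate" where
  "stages p w t st = seal_stage P w (complete_stage P w (refine_stage P t p w
     (ready_stage P t p w (echo_stage P t (\<lambda>_. True) (\<lambda>_ _. g = G1 \<and> 0 < t) p w st))))"

lemma step_stages: "step p w t inp st = stages p w t (input_stage P t p w inp st)"
  unfolding step_def local_step_def stages_def ..

lemma step_echo:
  assumes "finite A"
  shows "step p v 1 (Deliver q echo) (echoing p A) = echoing p (insert q A)"
proof -
  have le: "card A \<le> card (insert q A)" using assms by (simp add: card_insert_le)
  have "step p v 1 (Deliver q echo) (echoing p A) =
    stages p v 1 (counting (insert q A) (if Q \<le> card A then {p} else {}) {}
      (if Q \<le> card A then [echo, ready] else [echo]) [] [])"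
    unfolding step_stages input_stage_def echoing_def
    by (simp add: receive_counting del: receive.simps)
  also have "\<dots> = echoing p (insert q A)"
  \<comment> \<open>If \<open>A\<close> was a quorum already, the READY has been sent; otherwise it
    is sent now.\<close>
  proof (cases "Q \<le> card (insert q A)")
    case True
    then show ?thesis
      using Q_bounds le unfolding stages_def echoing_def
      by (cases "Q \<le> card A") (simp_all add: echo_stage_counting ready_stage_counting_sent
          ready_stage_counting_quorum refine_stage_counting complete_stage_counting
          seal_stage_counting)
  next
    case False
    then show ?thesis
      using Q_bounds le unfolding stages_def echoing_def
      by (simp add: echo_stage_counting ready_stage_counting_few refine_stage_counting
          complete_stage_counting seal_stage_counting)
  qed
  finally show ?thesis .
qed

lemma stages_readying:
  assumes "R \<inter> M = {}" "c = [] \<or> c = [B] \<and> Q \<le> card (R \<union> M)"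
    "l = [] \<or> l = [direct_result g B] \<and> Q \<le> card R"
  shows "stages p v 1 (counting {..<Q} R M [echo, ready] c l) = readying R M"
  using assms unfolding stages_def readying_def
  by (simp add: echo_stage_counting ready_stage_counting_sent refine_stage_counting
      complete_stage_counting seal_stage_counting)

lemma step_ready:
  assumes "finite R" "finite M" "R \<inter> M = {}" "q \<notin> M"
  shows "step p v 1 (Deliver q ready) (readying R M) = readying (insert q R) M"
proof -
  have "card R \<le> card (insert q R)" "card (R \<union> M) \<le> card (insert q R \<union> M)"
    using assms by (simp_all add: card_insert_le card_mono subset_iff)
  moreover have "step p v 1 (Deliver q ready) (readying R M) =
    stages p v 1 (counting {..<Q} (insert q R) M [echo, ready]
      (if Q \<le> card (R \<union> M) then [B] else []) (if Q \<le> card R then [direct_result g B] else []))"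
    using assms(4) unfolding step_stages input_stage_def readying_def
    by (simp add: receive_counting del: receive.simps)
  ultimately show ?thesis using assms(3,4) by (simp add: stages_readying)
qed

lemma step_mix:
  assumes "q \<noteq> p"
  shows "step p v 1 (Deliver q (Ready v Mix B)) (readying {p} {}) = readying {p} {q}"
proof -
  have "step p v 1 (Deliver q (Ready v Mix B)) (readying {p} {}) =
    stages p v 1 (counting {..<Q} {p} {q} [echo, ready] [] [])"
    using assms Q_bounds unfolding step_stages input_stage_def readying_def
    by (simp add: receive_counting del: receive.simps)
  then show ?thesis using assms by (simp add: stages_readying)
qed

text \<open>Before anything is counted and before the no-ready deadline at entry + 4, only the echo
  stage could act. This covers the steps at time 0 and all steps in other views.\<close>

lemma quiet_stages:
  assumes "echo_cnt st = (\<lambda>_. None)" "ready_cnt st = (\<lambda>_. None)" "sent st = []"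
    "completions st = []" "seals st = []" "\<And>e. entry st = Some e \<Longrightarrow> t < e + 4"
    "echo_response P t (\<lambda>_. True) (\<lambda>_ _. g = G1 \<and> 0 < t) w st = None"
  shows "stages p w t st = st"
proof -
  have no: "echo_authors w st B' = {}" "ready_authors w st B' = {}"
    "graded_ready_authors w st g' B' = {}" for g' B'
    using assms(1,2) by (simp_all add: echo_authors_def ready_authors_def graded_ready_authors_def)
  have 1: "echo_stage P t (\<lambda>_. True) (\<lambda>_ _. g = G1 \<and> 0 < t) p w st = st"
    using assms(7) by (simp add: echo_stage_def)
  have 2: "ready_stage P t p w st = st"
    using assms(6) no Q_bounds by (force simp: ready_stage_def)
  have 3: "refine_stage P t p w st = st"
    using assms(3) by (simp add: refine_stage_def refinable_def)
  have 4: "complete_stage P w st = st" "seal_stage P w st = st"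
    using no Q_bounds by (simp_all add: complete_stage_def seal_stage_def)
  show ?thesis unfolding stages_def 1 2 3 4 ..
qed

lemma step_enter: "step p v 0 (Enter v) init = init\<lparr>entry := Some 0\<rparr>"
  unfolding step_stages
  by (subst quiet_stages)
    (simp_all add: input_stage_def init_def echo_response_def)

lemma step_proposal:
  "step p v 0 (Deliver byz (Proposal v B)) (init\<lparr>entry := Some 0\<rparr>) = before_echo"
  unfolding step_stages
  by (subst quiet_stages)
    (simp_all add: input_stage_def before_echo_def init_def echo_response_def)

lemma step_tick: "step p v 1 Tick before_echo = echoing p {p}"
proof -
  \<comment> \<open>With entry and receipt at 0 the deadline is min (0 + 1) 3 = 1. At the deadline
    itself a grade-1 ECHO is still possible; for \<open>g = G0\<close> the tip predicate is false
    and the grade-0 ECHO is due.\<close>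
  have "echo_response P 1 (\<lambda>_. True) (\<lambda>_ _. g = G1) v before_echo = Some echo"
    by (cases g) (simp_all add: echo_response_def before_echo_def init_def)
  moreover have "echo_pending v before_echo"
    by (simp add: echo_pending_def before_echo_def init_def)
  moreover have "broadcast P 1 p echo before_echo = counting {p} {} {} [echo] [] []"
    by (auto simp: broadcast_def counting_def before_echo_def init_def)
  ultimately have "echo_stage P 1 (\<lambda>_. True) (\<lambda>_ _. g = G1) p v before_echo =
      counting {p} {} {} [echo] [] []"
    unfolding echo_stage_def by simp
  then show ?thesis
    using Q_bounds unfolding step_stages stages_def echoing_def
    by (simp add: input_stage_def ready_stage_counting_few refine_stage_counting
        complete_stage_counting seal_stage_counting)
qed

text \<open>Every event drives all views of its party, so the other views must be shown to stay
  idle.\<close>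

lemma step_other_view:
  assumes "w \<noteq> v" "t < 4" "inp \<in> {Enter v, Tick} \<or> (\<exists>a m. inp = Deliver a m \<and> view_of m = v)"
  shows "step p w t inp init = init"
proof -
  have "input_stage P t p w inp init = init"
    using assms(1,3) unfolding input_stage_def by auto
  then show ?thesis
    unfolding step_stages
    by (simp, subst quiet_stages) (simp_all add: init_def echo_response_def)
qed

subsection \<open>The schedule\<close>

definition deliveries :: "'m msg \<Rightarrow> party \<Rightarrow> party list \<Rightarrow> (real \<times> party \<times> 'm input) list" where
  "deliveries m p qs = map (\<lambda>q. (1, p, Deliver q m)) qs"

definition others :: "party \<Rightarrow> party list" where
  "others p = filter (\<lambda>q. q \<noteq> p) [0..<Q]"

definition proposals :: "(real \<times> party \<times> 'm input) list" where
  "proposals = concat (map (\<lambda>p. [(0, p, Enter v), (0, p, Deliver byz (Proposal v B))]) [0..<Q])"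

definition ticks :: "(real \<times> party \<times> 'm input) list" where
  "ticks = concat (map (\<lambda>p. [(1, p, Tick)]) [0..<Q])"

definition echo_deliveries :: "(real \<times> party \<times> 'm input) list" where
  "echo_deliveries = concat (map (\<lambda>p. deliveries echo p (others p)) [0..<Q])"

text \<open>Party 0 gets every READY, party 1 gets the READY-mix of the Byzantine party in place of
  the READY of party 2, and party 2 gets none.\<close>

definition split_deliveries :: "(real \<times> party \<times> 'm input) list" where
  "split_deliveries = deliveries ready 0 (others 0) @
     (1, 1, Deliver byz (Ready v Mix B)) # deliveries ready 1 (filter (\<lambda>q. q \<noteq> 2) (others 1))"

text \<open>Comes after the moment of interest and serves reliability of channels: every READY
  reaches every correct party. Repeated READYs leave the state unchanged.\<close>

definition ready_deliveries :: "(real \<times> party \<times> 'm input) list" where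
  "ready_deliveries = concat (map (\<lambda>p. deliveries ready p (others p)) [0..<Q])"

definition schedule :: "(real \<times> party \<times> 'm input) list" where
  "schedule = proposals @ ticks @ echo_deliveries @ split_deliveries @ ready_deliveries"

lemma set_schedule:
  "set (others p) = {..<Q} - {p}"
  "set (deliveries m p qs) = (\<lambda>q. (1, p, Deliver q m)) ` set qs"
  "set proposals = (\<Union>p\<in>{..<Q}. {(0, p, Enter v), (0, p, Deliver byz (Proposal v B))})"
  "set ticks = (\<Union>p\<in>{..<Q}. {(1, p, Tick)})"
  "set echo_deliveries = (\<Union>p\<in>{..<Q}. (\<lambda>q. (1, p, Deliver q echo)) ` ({..<Q} - {p}))"
  "set split_deliveries = (\<lambda>q. (1, 0, Deliver q ready)) ` ({..<Q} - {0}) \<union>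
     insert (1, 1, Deliver byz (Ready v Mix B))
       ((\<lambda>q. (1, 1, Deliver q ready)) ` ({..<Q} - {1, 2}))"
  "set ready_deliveries = (\<Union>p\<in>{..<Q}. (\<lambda>q. (1, p, Deliver q ready)) ` ({..<Q} - {p}))"
  unfolding others_def deliveries_def proposals_def ticks_def echo_deliveries_def
    split_deliveries_def ready_deliveries_def by auto

lemma deliveries_party: "e \<in> set (deliveries m p qs) \<Longrightarrow> fst (snd e) = p"
  unfolding deliveries_def by auto

section \<open>Effect of the phases on a single party\<close>

lemma run_echoes:
  "finite A \<Longrightarrow> run p v (deliveries echo p qs) (echoing p A) = echoing p (A \<union> set qs)"
  by (induction qs arbitrary: A) (auto simp: deliveries_def step_echo)

lemma run_readies:
  "finite R \<Longrightarrow> finite M \<Longrightarrow> (R \<union> set qs) \<inter> M = {} \<Longrightarrow>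
    run p v (deliveries ready p qs) (readying R M) = readying (R \<union> set qs) M"
  by (induction qs arbitrary: R) (auto simp: deliveries_def step_ready Int_Un_distrib2)

lemma run_proposals: "p < Q \<Longrightarrow> run p v proposals init = before_echo"
  unfolding proposals_def
  by (subst run_blocks) (auto simp: step_enter step_proposal)

lemma run_ticks: "p < Q \<Longrightarrow> run p v ticks before_echo = echoing p {p}"
  unfolding ticks_def by (subst run_blocks) (auto simp: step_tick)

lemma run_echo_deliveries:
  assumes "p < Q"
  shows "run p v echo_deliveries (echoing p {p}) = readying {p} {}"
proof -
  have "insert p ({..<Q} - {p}) = {..<Q}" using assms by auto
  then show ?thesis
    unfolding echo_deliveries_def using assms
    by (subst run_blocks)
      (auto simp: run_echoes set_schedule(1) echoing_readying[symmetric] dest: deliveries_party)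
qed

lemma run_deliveries_other: "p \<noteq> q \<Longrightarrow> run q w (deliveries m p qs) st = st"
  by (rule run_other) (auto dest: deliveries_party)

lemma run_split_deliveries:
  assumes "p < Q"
  shows "run p v split_deliveries (readying {p} {}) =
    (if p = 0 then readying {..<Q} {} else if p = 1 then readying ({..<Q} - {2}) {byz}
     else readying {p} {})"
proof -
  have "insert 0 ({..<Q} - {0}) = {..<Q}" "insert 1 ({..<Q} - {1, 2}) = {..<Q} - {2}"
    "set (filter (\<lambda>q. q \<noteq> 2) (others 1)) = {..<Q} - {1, 2}"
    using Q_bounds by (auto simp: set_schedule)
  moreover have "byz \<noteq> 1" using Q_bounds byz_bounds by linarith
  moreover have "(insert 1 ({..<Q} - {1, 2})) \<inter> {byz} = {}" using byz_bounds Q_bounds by auto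
  ultimately show ?thesis
    unfolding split_deliveries_def
    by (auto simp: run_deliveries_other run_readies step_mix set_schedule(1) simp del: set_filter)
qed

text \<open>The exact \<open>R'\<close> is irrelevant: every \<open>readying\<close> state has the
  same sent messages, and only these are needed at the end of the run.\<close>

lemma run_ready_deliveries:
  assumes "p < Q" "finite R" "finite M" "M \<subseteq> {Q..}" "R \<subseteq> {..<Q}"
  shows "\<exists>R'. run p v ready_deliveries (readying R M) = readying R' M"
proof -
  have "(R \<union> set (others p)) \<inter> M = {}" using assms(4,5) by (fastforce simp: set_schedule(1))
  then show ?thesis
    unfolding ready_deliveries_def using assms(1-3)
    by (subst run_blocks) (auto simp: run_readies dest: deliveries_party)
qed

lemma run_other_view:
  assumes "w \<noteq> v" "\<And>t p inp. (t, p, inp) \<in> set xs \<Longrightarrow>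
    t < 4 \<and> (inp \<in> {Enter v, Tick} \<or> (\<exists>a m. inp = Deliver a m \<and> view_of m = v))"
  shows "run p w xs init = init"
  using assms(2)
proof (induction xs)
  case (Cons e xs)
  obtain t q inp where e: "e = (t, q, inp)" by (cases e)
  have "step q w t inp init = init"
    by (rule step_other_view[OF assms(1)]) (use Cons.prems[of t q inp] e in auto)
  moreover have "run p w xs init = init" using Cons.IH Cons.prems by (meson list.set_intros(2))
  ultimately show ?case unfolding e by (cases "q = p") auto
qed simp

text \<open>The clock shows 0 exactly during \<open>proposals\<close>, so the index test in
  \<open>tipOK\<close> agrees with the condition \<open>0 < t\<close> of
  \<open>step\<close>.\<close>

definition exec :: "('m, 'x) execution" where
  "exec = \<lparr>event = (\<lambda>k. if k < length schedule then Some (snd (schedule ! k)) else None),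
     clock = (\<lambda>i k. if k < length proposals then 0 else 1),
     coreOK = (\<lambda>i k M. True), tipOK = (\<lambda>i k M M'. g = G1 \<and> length proposals \<le> k),
     retrievable = (\<lambda>k x. True)\<rparr>"

lemma schedule_time:
  assumes "k < length schedule"
  shows "fst (schedule ! k) = (if k < length proposals then 0 else 1)"
proof (cases "k < length proposals")
  case True
  then have "schedule ! k \<in> set proposals" by (simp add: schedule_def nth_append)
  then show ?thesis using True by (auto simp: set_schedule)
next
  case False
  define xs where "xs = ticks @ echo_deliveries @ split_deliveries @ ready_deliveries"
  have "schedule ! k \<in> set xs"
    using False assms unfolding schedule_def xs_def[symmetric] by (simp add: nth_append)
  then show ?thesis using False by (auto simp: xs_def set_schedule)
qed

lemma state_exec: "state P exec k p w = run p w (take k schedule) init"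
proof (induction k arbitrary: p w)
  case (Suc k)
  show ?case
  proof (cases "k < length schedule")
    case True
    obtain t q inp where e: "schedule ! k = (t, q, inp)" by (cases "schedule ! k")
    have t: "t = (if k < length proposals then 0 else 1)"
      using schedule_time[OF True] e by simp
    have "state P exec (Suc k) p w =
      (if q = p then step p w t inp (state P exec k p w) else state P exec k p w)"
      using True e unfolding t by (simp add: exec_def step_def)
    then show ?thesis using Suc True e by (simp add: take_Suc_conv_app_nth)
  next
    case False
    then show ?thesis using Suc by (simp add: exec_def)
  qed
qed simp

lemma schedule_events:
  "e \<in> set schedule \<Longrightarrow> fst e < 4 \<and> fst (snd e) < Q \<and>
    (snd (snd e) \<in> {Enter v, Tick} \<or> (\<exists>a m. snd (snd e) = Deliver a m \<and> view_of m = v))"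
  using Q_bounds unfolding schedule_def by (auto simp: set_schedule)

lemma state_other_view:
  assumes "w \<noteq> v"
  shows "state P exec k p w = init"
  unfolding state_exec
proof (rule run_other_view[OF assms])
  fix t q inp assume "(t, q, inp) \<in> set (take k schedule)"
  from schedule_events[OF in_set_takeD[OF this]]
  show "t < 4 \<and> (inp \<in> {Enter v, Tick} \<or> (\<exists>a m. inp = Deliver a m \<and> view_of m = v))"
    by simp
qed

section \<open>States at the boundaries of the phases\<close>

definition split_time :: nat where
  "split_time = length (proposals @ ticks @ echo_deliveries @ split_deliveries)"

lemma state_echoed:
  "p < Q \<Longrightarrow> state P exec (length (proposals @ ticks)) p v = echoing p {p}"
  unfolding state_exec schedule_def by (simp add: run_proposals run_ticks)

lemma state_readied:
  "p < Q \<Longrightarrow> state P exec (length (proposals @ ticks @ echo_deliveries)) p v = readying {p} {}"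
  unfolding state_exec schedule_def by (simp add: run_proposals run_ticks run_echo_deliveries)

lemma state_split:
  "p < Q \<Longrightarrow> state P exec split_time p v =
    (if p = 0 then readying {..<Q} {} else if p = 1 then readying ({..<Q} - {2}) {byz}
     else readying {p} {})"
  unfolding state_exec schedule_def split_time_def
  by (simp add: run_proposals run_ticks run_echo_deliveries run_split_deliveries)

lemma state_final:
  assumes "p < Q" "length schedule \<le> k"
  shows "\<exists>R M. state P exec k p v = readying R M"
proof -
  let ?st = "if p = 0 then readying {..<Q} {} else if p = 1 then readying ({..<Q} - {2}) {byz}
     else readying {p} {}"
  have "state P exec k p v = run p v ready_deliveries ?st"
    unfolding state_exec using assms unfolding schedule_def
    by (simp add: run_proposals run_ticks run_echo_deliveries run_split_deliveries)
  moreover have "\<exists>R M. run p v ready_deliveries ?st = readying R M"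
    using run_ready_deliveries[OF assms(1), of "{..<Q}" "{}"]
      run_ready_deliveries[OF assms(1), of "{..<Q} - {2}" "{byz}"]
      run_ready_deliveries[OF assms(1), of "{p}" "{}"] assms(1) byz_bounds by auto
  ultimately show ?thesis by simp
qed

text \<open>Sent messages persist, so the final state bounds everything a correct party ever sends.
  This makes the reliability of channels a finite check.\<close>

lemma sent_final:
  assumes "p < Q" "has_sent P exec p k m"
  shows "m \<in> {echo, ready}"
proof -
  have v: "view_of m = v"
    using assms(2) state_other_view unfolding has_sent_def by (fastforce simp: init_def)
  have "has_sent P exec p (max k (length schedule)) m" using assms(2) has_sent_mono by fastforce
  moreover obtain R M where "state P exec (max k (length schedule)) p v = readying R M"
    using state_final assms(1) by (metis max.cobounded2)
  ultimately show ?thesis unfolding has_sent_def v by (simp add: readying_def)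
qed

lemma has_sent_echo:
  assumes "p < Q" "length (proposals @ ticks) \<le> k"
  shows "has_sent P exec p k echo"
proof (rule has_sent_mono[OF _ assms(2)])
  show "has_sent P exec p (length (proposals @ ticks)) echo"
    unfolding has_sent_def view_of.simps state_echoed[OF assms(1)] by (simp add: echoing_def)
qed

lemma has_sent_ready:
  assumes "p < Q" "length (proposals @ ticks @ echo_deliveries) \<le> k"
  shows "has_sent P exec p k ready"
proof (rule has_sent_mono[OF _ assms(2)])
  show "has_sent P exec p (length (proposals @ ticks @ echo_deliveries)) ready"
    unfolding has_sent_def view_of.simps state_readied[OF assms(1)] by (simp add: readying_def)
qed

text \<open>Authenticity holds by phase: every correct party has echoed before the ECHO deliveries
  begin and has sent its READY before the READY deliveries begin. The remaining deliveries come from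
  the Byzantine party.\<close>

lemma deliver_exec:
  assumes "event exec k = Some (i, Deliver a m)"
  shows "a < n \<and> a \<noteq> i \<and> (a < Q \<longrightarrow> has_sent P exec a k m)"
proof -
  obtain t where k: "k < length schedule" "schedule ! k = (t, i, Deliver a m)"
    using assms by (cases "schedule ! k") (auto simp: exec_def split: if_splits)
  consider "schedule ! k \<in> set (proposals @ ticks)"
    | "length (proposals @ ticks) \<le> k" "schedule ! k \<in> set echo_deliveries"
    | "length (proposals @ ticks @ echo_deliveries) \<le> k"
      "schedule ! k \<in> set (split_deliveries @ ready_deliveries)"
  proof -
    define xs ys zs where "xs = proposals @ ticks" and "ys = echo_deliveries"
      and "zs = split_deliveries @ ready_deliveries"
    have sch: "schedule = xs @ ys @ zs" unfolding schedule_def xs_def ys_def zs_def by simp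
    have "k < length xs \<or> length xs \<le> k \<and> k - length xs < length ys \<or>
      length (xs @ ys) \<le> k \<and> k - length (xs @ ys) < length zs"
      using k(1) unfolding sch by auto
    then have "schedule ! k \<in> set xs \<or> length xs \<le> k \<and> schedule ! k \<in> set ys \<or>
      length (xs @ ys) \<le> k \<and> schedule ! k \<in> set zs"
      unfolding sch by (auto simp: nth_append)
    then show ?thesis using that unfolding xs_def ys_def zs_def by auto
  qed
  then show ?thesis
  proof cases
    case 1
    then show ?thesis using k(2) Q_bounds byz_bounds by (auto simp: set_schedule)
  next
    case 2
    then show ?thesis using k(2) Q_bounds has_sent_echo[OF _ 2(1)] by (auto simp: set_schedule)
  next
    case 3
    then show ?thesis
      using k(2) Q_bounds byz_bounds has_sent_ready[OF _ 3(1)] by (auto simp: set_schedule)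
  qed
qed

lemma received_exec:
  assumes "i < Q" "a < Q" "has_sent P exec a k m"
  shows "\<exists>k'. has_received P exec i k' a m"
proof (cases "i = a")
  case True
  then show ?thesis using assms(3) unfolding has_received_def by blast
next
  case False
  then have "(1, i, Deliver a m) \<in> set schedule"
    using sent_final[OF assms(2,3)] assms(1,2) unfolding schedule_def by (auto simp: set_schedule)
  then obtain k' where "k' < length schedule" "schedule ! k' = (1, i, Deliver a m)"
    by (metis in_set_conv_nth)
  then have "event exec k' = Some (i, Deliver a m)" by (simp add: exec_def)
  then show ?thesis unfolding has_received_def by (meson lessI)
qed

lemma execution_exec: "execution P exec"
  unfolding execution_def
proof (intro conjI allI impI)
  show "mono (clock exec i)" for i by (auto simp: exec_def mono_def)
  show "correct P i" if "event exec k = Some (i, inp)" for k i inp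
  proof -
    have "k < length schedule" "fst (snd (schedule ! k)) = i"
      using that by (auto simp: exec_def split: if_splits)
    then show ?thesis using schedule_events[OF nth_mem, of k] by simp
  qed
qed (use system_P deliver_exec received_exec in auto)

lemma contract_exec: "eligibility_contract P exec"
  unfolding eligibility_contract_def witnessed_def by simp

text \<open>Party 1 counts Q - 1 homogeneous READYs and one READY-mix: enough to complete, one short
  of a seal. Party 2 has counted only its own READY.\<close>

lemma split_outcomes:
  "direct_result g B \<in> set (seals (state P exec split_time 0 v))"
  "open_tip (state P exec split_time 1 v) B"
  "completions (state P exec split_time 2 v) = []"
proof -
  have "card ({..<Q} - {2}) = Q - 1" "({..<Q} - {2}) \<inter> {byz} = {}"
    using Q_bounds byz_bounds by (auto simp: card_Diff_singleton)
  then have "card (({..<Q} - {2}) \<union> {byz}) = Q" "card ({..<Q} - {2}) < Q"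
    using Q_bounds by (simp_all add: card_Un_disjoint)
  then show "open_tip (state P exec split_time 1 v) B"
    using Q_bounds by (simp add: state_split open_tip_def readying_def)
  show "direct_result g B \<in> set (seals (state P exec split_time 0 v))"
    "completions (state P exec split_time 2 v) = []"
    using Q_bounds by (simp_all add: state_split readying_def)
qed

end

theorem theoremB7:
  fixes P :: "('m, 'x) params" and E :: "('m, 'x) execution" and v :: view
  assumes "execution P E"
  shows
    \<comment> \<open>(a) local uniqueness and sender integrity\<close>
    "(\<forall>i k. correct P i \<longrightarrow>
        length (completions (state P E k i v)) \<le> 1 \<and> length (seals (state P E k i v)) \<le> 1) \<and>
     (\<forall>i k B. correct P i \<longrightarrow> B \<in> set (completions (state P E k i v)) \<longrightarrow>
        (\<exists>j g. correct P j \<and> has_sent P E j k (Echo v g B) \<and>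
           has_received P E j k (proposer P v) (Proposal v B))) \<and>
     (\<forall>k0 C T. correct P (proposer P v) \<longrightarrow>
        has_sent P E (proposer P v) k0 (Proposal v (C, T)) \<longrightarrow>
        (\<forall>i k. correct P i \<longrightarrow>
           (\<forall>B \<in> set (completions (state P E k i v)). B = (C, T)) \<and>
           (\<forall>R \<in> set (seals (state P E k i v)). R = Commit_Full C T \<or> R = Commit_Core C))) \<and>
     \<comment> \<open>(b) value agreement\<close>
     (\<exists>Bv. \<forall>i k B. correct P i \<longrightarrow>
        (\<exists>g. has_sent P E i k (Ready v g B)) \<or>
        ready_quorum P v (state P E k i v) B \<or>
        B \<in> set (completions (state P E k i v)) \<longrightarrow>
        B = Bv \<and> (\<exists>j. correct P j \<and> has_received P E j k (proposer P v) (Proposal v Bv))) \<and>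
     \<comment> \<open>(c) grade compatibility\<close>
     (\<forall>i k B i' k' B'. correct P i \<longrightarrow> correct P i' \<longrightarrow>
        \<not> (graded_ready_quorum P v (state P E k i v) G1 B \<and>
           graded_ready_quorum P v (state P E k' i' v) G0 B')) \<and>
     (\<forall>i k C T i' k' C'. correct P i \<longrightarrow> correct P i' \<longrightarrow>
        \<not> (Commit_Full C T \<in> set (seals (state P E k i v)) \<and>
           Commit_Core C' \<in> set (seals (state P E k' i' v)))) \<and>
     (1 \<le> nfaulty P \<longrightarrow>
        (\<forall>g. \<exists>(P' :: ('m, 'x) params) E' i j l k C T.
           nparties P' = nparties P \<and> nfaulty P' = nfaulty P \<and>
           execution P' E' \<and> eligibility_contract P' E' \<and>
           correct P' i \<and> correct P' j \<and> correct P' l \<and> distinct [i, j, l] \<and>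
           direct_result g (C, T) \<in> set (seals (state P' E' k i v)) \<and>
           open_tip (state P' E' k j v) (C, T) \<and>
           completions (state P' E' k l v) = [])) \<and>
     \<comment> \<open>(d) eligibility witness\<close>
     (eligibility_contract P E \<longrightarrow>
        (\<forall>i k C T. correct P i \<longrightarrow>
           ((C, T) \<in> set (completions (state P E k i v)) \<longrightarrow> witnessed P E k C) \<and>
           (graded_ready_quorum P v (state P E k i v) G1 (C, T) \<longrightarrow> witnessed P E k T))) \<and>
     (\<forall>V :: ('m, 'h, 'd) vantage. vantage_execution P E V \<longrightarrow>
        (\<forall>i k C T. correct P i \<longrightarrow>
           ((C, T) \<in> set (completions (state P E k i v)) \<longrightarrow> lanes_witnessed P V k C) \<and>
           (graded_ready_quorum P v (state P E k i v) G1 (C, T) \<longrightarrow> lanes_witnessed P V k T))) \<and>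
     \<comment> \<open>(e) ready-refusal exclusion\<close>
     (\<forall>i k B i' k'. correct P i \<longrightarrow> correct P i' \<longrightarrow>
        \<not> (ready_quorum P v (state P E k i v) B \<and> no_ready_quorum P v (state P E k' i' v)))"
proof (intro conjI)
  note ex = assms
  show "\<forall>i k. correct P i \<longrightarrow>
      length (completions (state P E k i v)) \<le> 1 \<and> length (seals (state P E k i v)) \<le> 1"
    using state_local_inv unfolding local_inv_def results_ok_def by blast
  show "\<forall>i k B. correct P i \<longrightarrow> B \<in> set (completions (state P E k i v)) \<longrightarrow>
      (\<exists>j g. correct P j \<and> has_sent P E j k (Echo v g B) \<and>
         has_received P E j k (proposer P v) (Proposal v B))"
    using completion_echoer[OF ex] has_sent_Echo[OF ex] by metis
  show "\<forall>k0 C T. correct P (proposer P v) \<longrightarrow>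
      has_sent P E (proposer P v) k0 (Proposal v (C, T)) \<longrightarrow>
      (\<forall>i k. correct P i \<longrightarrow>
         (\<forall>B \<in> set (completions (state P E k i v)). B = (C, T)) \<and>
         (\<forall>R \<in> set (seals (state P E k i v)). R = Commit_Full C T \<or> R = Commit_Core C))"
  proof (intro allI impI conjI ballI)
    fix k0 C T i k
    assume pr: "correct P (proposer P v)" "has_sent P E (proposer P v) k0 (Proposal v (C, T))"
      and i: "correct P i"
    show "B = (C, T)" if B: "B \<in> set (completions (state P E k i v))" for B
      using completion_echoer[OF ex i B] correct_proposer_echo[OF ex pr] by metis
    show "R = Commit_Full C T \<or> R = Commit_Core C" if R: "R \<in> set (seals (state P E k i v))" for R
    proof -
      obtain a g B where R: "R = direct_result g B" "has_sent P E a k (Echo v g B)"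
        using seal_echoer[OF ex i R] by metis
      then have "B = (C, T)" using correct_proposer_echo[OF ex pr] by metis
      then show ?thesis using R(1) by (cases g) simp_all
    qed
  qed
  show "\<exists>Bv. \<forall>i k B. correct P i \<longrightarrow>
      (\<exists>g. has_sent P E i k (Ready v g B)) \<or>
      ready_quorum P v (state P E k i v) B \<or>
      B \<in> set (completions (state P E k i v)) \<longrightarrow>
      B = Bv \<and> (\<exists>j. correct P j \<and> has_received P E j k (proposer P v) (Proposal v Bv))"
    by (rule value_agreement[OF ex])
  show "\<forall>i k B i' k' B'. correct P i \<longrightarrow> correct P i' \<longrightarrow>
      \<not> (graded_ready_quorum P v (state P E k i v) G1 B \<and>
         graded_ready_quorum P v (state P E k' i' v) G0 B')"
    using graded_ready_quorums_agree[OF ex] unfolding graded_ready_quorum_iff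
    by (metis grade.distinct(1))
  show "\<forall>i k C T i' k' C'. correct P i \<longrightarrow> correct P i' \<longrightarrow>
      \<not> (Commit_Full C T \<in> set (seals (state P E k i v)) \<and>
         Commit_Core C' \<in> set (seals (state P E k' i' v)))"
    using seals_not_conflicting[OF ex] by metis
  show "1 \<le> nfaulty P \<longrightarrow>
      (\<forall>g. \<exists>(P' :: ('m, 'x) params) E' i j l k C T.
         nparties P' = nparties P \<and> nfaulty P' = nfaulty P \<and>
         execution P' E' \<and> eligibility_contract P' E' \<and>
         correct P' i \<and> correct P' j \<and> correct P' l \<and> distinct [i, j, l] \<and>
         direct_result g (C, T) \<in> set (seals (state P' E' k i v)) \<and>
         open_tip (state P' E' k j v) (C, T) \<and>
         completions (state P' E' k l v) = [])"
  proof (intro impI allI)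
    fix g assume f: "1 \<le> nfaulty P"
    define P' :: "('m, 'x) params" where "P' = \<lparr>nparties = nparties P, nfaulty = nfaulty P,
      byzantine = {nparties P - nfaulty P..<nparties P}, proposer = (\<lambda>_. nparties P - 1),
      formed = (\<lambda>_ _. True), Delta = 1, items = (\<lambda>_. []), ext_valid = (\<lambda>_. True)\<rparr>"
    \<comment> \<open>Any two manifests would do, hence \<open>undefined\<close>; only the numbers
      of parties and of faults are shared with \<open>P\<close>.\<close>
    interpret split_run "nparties P" "nfaulty P" v g undefined undefined P'
      using f system[OF ex] by unfold_locales (auto simp: P'_def system_def)
    have "nparties P' = nparties P \<and> nfaulty P' = nfaulty P \<and>
         execution P' exec \<and> eligibility_contract P' exec \<and>
         correct P' 0 \<and> correct P' 1 \<and> correct P' 2 \<and> distinct [0, 1, 2 :: party] \<and>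
         direct_result g (undefined, undefined) \<in> set (seals (state P' exec split_time 0 v)) \<and>
         open_tip (state P' exec split_time 1 v) (undefined, undefined) \<and>
         completions (state P' exec split_time 2 v) = []"
      using execution_exec contract_exec split_outcomes Q_bounds by simp
    then show "\<exists>(P' :: ('m, 'x) params) E' i j l k C T.
         nparties P' = nparties P \<and> nfaulty P' = nfaulty P \<and>
         execution P' E' \<and> eligibility_contract P' E' \<and>
         correct P' i \<and> correct P' j \<and> correct P' l \<and> distinct [i, j, l] \<and>
         direct_result g (C, T) \<in> set (seals (state P' E' k i v)) \<and>
         open_tip (state P' E' k j v) (C, T) \<and>
         completions (state P' E' k l v) = []"
      by (intro exI)
  qed
  show "eligibility_contract P E \<longrightarrow>
      (\<forall>i k C T. correct P i \<longrightarrow>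
         ((C, T) \<in> set (completions (state P E k i v)) \<longrightarrow> witnessed P E k C) \<and>
         (graded_ready_quorum P v (state P E k i v) G1 (C, T) \<longrightarrow> witnessed P E k T))"
  proof (intro impI allI conjI)
    fix i k C T assume contract: "eligibility_contract P E" and i: "correct P i"
    show "witnessed P E k C" if named: "(C, T) \<in> set (completions (state P E k i v))"
    proof -
      obtain a g where "correct P a" "has_sent P E a k (Echo v g (C, T))"
        using completion_echoer[OF ex i named] by metis
      then show ?thesis using echo_witnessed(1)[OF ex contract] by fastforce
    qed
    show "witnessed P E k T" if named: "graded_ready_quorum P v (state P E k i v) G1 (C, T)"
    proof -
      obtain a where "correct P a" "has_sent P E a k (Echo v G1 (C, T))"
        using graded_ready_quorum_echoer[OF ex i named[unfolded graded_ready_quorum_iff]] by metis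
      then show ?thesis using echo_witnessed(2)[OF ex contract] by fastforce
    qed
  qed
  show "\<forall>V :: ('m, 'h, 'd) vantage. vantage_execution P E V \<longrightarrow>
      (\<forall>i k C T. correct P i \<longrightarrow>
         ((C, T) \<in> set (completions (state P E k i v)) \<longrightarrow> lanes_witnessed P V k C) \<and>
         (graded_ready_quorum P v (state P E k i v) G1 (C, T) \<longrightarrow> lanes_witnessed P V k T))"
  proof (intro impI allI conjI)
    fix V :: "('m, 'h, 'd) vantage" and i k C T
    assume ve: "vantage_execution P E V" and i: "correct P i"
    show "lanes_witnessed P V k C" if named: "(C, T) \<in> set (completions (state P E k i v))"
    proof -
      obtain a g where "correct P a" "has_sent P E a k (Echo v g (C, T))"
        using completion_echoer[OF ex i named] by metis
      then show ?thesis using echo_lanes_witnessed(1)[OF ve] by blast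
    qed
    show "lanes_witnessed P V k T" if named: "graded_ready_quorum P v (state P E k i v) G1 (C, T)"
    proof -
      obtain a where "correct P a" "has_sent P E a k (Echo v G1 (C, T))"
        using graded_ready_quorum_echoer[OF ex i named[unfolded graded_ready_quorum_iff]] by metis
      then show ?thesis using echo_lanes_witnessed(2)[OF ve] by blast
    qed
  qed
  show "\<forall>i k B i' k'. correct P i \<longrightarrow> correct P i' \<longrightarrow>
      \<not> (ready_quorum P v (state P E k i v) B \<and> no_ready_quorum P v (state P E k' i' v))"
    using ready_no_ready_exclusive[OF ex] unfolding ready_quorum_iff no_ready_quorum_iff by metis
qed

end
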